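(* Let $n\ge 2$ be even. For every graph $G\in\mathbb{G}_{n,n/2}$, $\rho(G)\ge\rho(P_{n/2}\circ K_1)$, with equality if and only if $G\cong P_{n/2}\circ K_1$.
   Context: $\rho(G)$ is the spectral radius (largest adjacency eigenvalue) of $G$. The domination number of a graph is the minimum size of a vertex set $D$ such that every vertex outside $D$ is adjacent to a vertex of $D$; $\mathbb{G}_{n,\gamma}$ is the set of simple connected graphs on $n$ vertices with domination number $\gamma$. $P_k$ is the path on $k$ vertices. For a graph $H$, the corona $H\circ K_1$ is obtained from $H$ by adding, for each vertex $v\in V(H)$, a new vertex $v'$ and the edge $vv'$. *)

theory Defs
  imports "Graph_Theory.Graph_Theory" "Jordan_Normal_Form.Spectral_Radius"
begin

text \<open>
  A finite simple graph is a symmetric loop-free pair digraph (locale \<^locale>\<open>pair_graph\<close>):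
  each undirected edge uv is represented by the two arcs (u,v) and (v,u).
\<close>

definition adjacency_mat :: "'a pair_pre_digraph \<Rightarrow> 'a list \<Rightarrow> real mat" where
  "adjacency_mat G vs =
     mat (length vs) (length vs) (\<lambda>(i, j). if (vs ! i, vs ! j) \<in> parcs G then 1 else 0)"

text \<open>
  The spectrum is taken over the reals, so the maximum is the largest (signed) eigenvalue. The choice
  of the enumeration of the vertices is immaterial, see \<open>graph_spectral_radius_eq\<close> below.
\<close>

definition graph_spectral_radius :: "'a pair_pre_digraph \<Rightarrow> real" where
  "graph_spectral_radius G =
     Max (spectrum (adjacency_mat G (SOME vs. distinct vs \<and> set vs = pverts G)))"

definition dominating_set :: "'a pair_pre_digraph \<Rightarrow> 'a set \<Rightarrow> bool" where
  "dominating_set G D \<longleftrightarrow>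
     D \<subseteq> pverts G \<and> (\<forall>v \<in> pverts G - D. \<exists>u \<in> D. (u, v) \<in> parcs G)"

definition domination_number :: "'a pair_pre_digraph \<Rightarrow> nat" where
  "domination_number G = Min (card ` {D. dominating_set G D})"

definition connected_graphs_dom :: "nat \<Rightarrow> nat \<Rightarrow> 'a pair_pre_digraph set" where
  "connected_graphs_dom n \<gamma> =
     {G. pair_graph G \<and> Digraph_Component.connected (with_proj G) \<and>
         card (pverts G) = n \<and> domination_number G = \<gamma>}"

definition path_graph :: "nat \<Rightarrow> nat pair_pre_digraph" where
  "path_graph k =
     \<lparr> pverts = {..<k}, parcs = {(i, j). i < k \<and> j < k \<and> (j = Suc i \<or> i = Suc j)} \<rparr>"

text \<open>The corona with a single vertex: \<open>Inl v\<close> is the original vertex v, \<open>Inr v\<close> its new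
  pendant neighbour.\<close>

definition corona_K1 :: "'a pair_pre_digraph \<Rightarrow> ('a + 'a) pair_pre_digraph" where
  "corona_K1 H =
     \<lparr> pverts = pverts H <+> pverts H,
       parcs = {(Inl u, Inl v) | u v. (u, v) \<in> parcs H}
             \<union> {(Inl v, Inr v) | v. v \<in> pverts H}
             \<union> {(Inr v, Inl v) | v. v \<in> pverts H} \<rparr>"

lemma pair_graph_path_graph: "pair_graph (path_graph k)"
proof
  show "finite (parcs (path_graph k))"
    by (rule finite_subset[of _ "{..<k} \<times> {..<k}"]) (auto simp: path_graph_def)
qed (auto simp: path_graph_def symmetric_def sym_def)

lemma pair_graph_corona_K1:
  assumes "pair_graph H"
  shows "pair_graph (corona_K1 H)"
proof -
  interpret pair_graph H by (rule assms)
  have wf: "u \<in> pverts H" "v \<in> pverts H" "u \<noteq> v" "(v, u) \<in> parcs H" if "(u, v) \<in> parcs H" for u v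
    using that arc_fst_in_verts arc_snd_in_verts pair_no_loops pair_sym_arcs
    by (fastforce simp: symmetric_def sym_def)+
  show ?thesis
  proof
    show "finite (parcs (corona_K1 H))"
      by (rule finite_subset[of _ "(pverts H <+> pverts H) \<times> (pverts H <+> pverts H)"])
        (auto simp: corona_K1_def wf)
  qed (auto simp: corona_K1_def symmetric_def sym_def wf)
qed

lemma eigenvalue_adjacency_mat_iff:
  assumes "distinct vs"
  shows "eigenvalue (adjacency_mat G vs) k \<longleftrightarrow>
    (\<exists>f. (\<exists>v \<in> set vs. f v \<noteq> 0) \<and>
         (\<forall>v \<in> set vs. (\<Sum>u \<in> {u \<in> set vs. (v, u) \<in> parcs G}. f u) = k * f v))"
    (is "?L \<longleftrightarrow> ?R")
proof -
  let ?n = "length vs"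
  have bij: "bij_betw ((!) vs) {..<?n} (set vs)"
    using assms by (rule bij_betw_nth) auto
  have sum: "(\<Sum>u \<in> {u \<in> set vs. (v, u) \<in> parcs G}. f u) =
      (\<Sum>j<?n. (if (v, vs ! j) \<in> parcs G then 1 else 0) * f (vs ! j))" for v and f :: "'a \<Rightarrow> real"
  proof -
    have "(\<Sum>u \<in> {u \<in> set vs. (v, u) \<in> parcs G}. f u) =
        (\<Sum>u \<in> set vs. (if (v, u) \<in> parcs G then 1 else 0) * f u)"
      by (rule sum.mono_neutral_cong_left) auto
    also have "\<dots> = (\<Sum>j<?n. (if (v, vs ! j) \<in> parcs G then 1 else 0) * f (vs ! j))"
      by (rule sum.reindex_bij_betw[OF bij, symmetric])
    finally show ?thesis .
  qed
  have row: "(adjacency_mat G vs *\<^sub>v x) $ i =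
      (\<Sum>j<?n. (if (vs ! i, vs ! j) \<in> parcs G then 1 else 0) * x $ j)"
    if "x \<in> carrier_vec ?n" "i < ?n" for x i
    using that by (simp add: adjacency_mat_def scalar_prod_def lessThan_atLeast0)
  show ?thesis
  proof
    assume ?L
    then obtain x where x: "x \<in> carrier_vec ?n" "x \<noteq> 0\<^sub>v ?n" "adjacency_mat G vs *\<^sub>v x = k \<cdot>\<^sub>v x"
      by (auto simp: eigenvalue_def eigenvector_def adjacency_mat_def)
    define f where "f v = x $ (the_inv_into {..<?n} ((!) vs) v)" for v
    have f: "f (vs ! i) = x $ i" if "i < ?n" for i
      using that bij by (simp add: f_def bij_betw_def the_inv_into_f_f)
    from x(1,2) obtain i where "i < ?n" "x $ i \<noteq> 0" by (metis carrier_vecD eq_vecI index_zero_vec)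
    hence "\<exists>v \<in> set vs. f v \<noteq> 0" using f by (metis nth_mem)
    moreover have "(\<Sum>u \<in> {u \<in> set vs. (v, u) \<in> parcs G}. f u) = k * f v" if v: "v \<in> set vs" for v
    proof -
      from v obtain i where i: "i < ?n" "v = vs ! i" by (metis in_set_conv_nth)
      have "(\<Sum>u \<in> {u \<in> set vs. (v, u) \<in> parcs G}. f u) = (adjacency_mat G vs *\<^sub>v x) $ i"
        unfolding sum row[OF x(1) i(1)] i(2) by (simp add: f)
      thus ?thesis using x i f by simp
    qed
    ultimately show ?R by blast
  next
    assume ?R
    then obtain f where f: "\<exists>v \<in> set vs. f v \<noteq> 0"
      "\<And>v. v \<in> set vs \<Longrightarrow> (\<Sum>u \<in> {u \<in> set vs. (v, u) \<in> parcs G}. f u) = k * f v" by blast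
    define x where "x = vec ?n (\<lambda>i. f (vs ! i))"
    have x: "x \<in> carrier_vec ?n" by (simp add: x_def)
    from f(1) obtain i where "i < ?n" "f (vs ! i) \<noteq> 0" by (metis in_set_conv_nth)
    hence "x \<noteq> 0\<^sub>v ?n" by (metis index_vec index_zero_vec(1) x_def)
    moreover have "adjacency_mat G vs *\<^sub>v x = k \<cdot>\<^sub>v x"
    proof (rule eq_vecI)
      fix i assume "i < dim_vec (k \<cdot>\<^sub>v x)"
      hence i: "i < ?n" by (simp add: x_def)
      have "(adjacency_mat G vs *\<^sub>v x) $ i =
          (\<Sum>u \<in> {u \<in> set vs. (vs ! i, u) \<in> parcs G}. f u)"
        unfolding sum row[OF x i] by (simp add: x_def)
      thus "(adjacency_mat G vs *\<^sub>v x) $ i = (k \<cdot>\<^sub>v x) $ i" using f(2) i by (simp add: x_def)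
    qed (simp add: x_def adjacency_mat_def)
    ultimately show ?L
      using x by (auto simp: eigenvalue_def eigenvector_def adjacency_mat_def)
  qed
qed

lemma graph_spectral_radius_eq:
  assumes "distinct vs" "set vs = pverts G"
  shows "graph_spectral_radius G = Max (spectrum (adjacency_mat G vs))"
proof -
  let ?ws = "SOME vs. distinct vs \<and> set vs = pverts G"
  have "distinct ?ws \<and> set ?ws = pverts G" using assms by (intro someI) blast
  hence "spectrum (adjacency_mat G ?ws) = spectrum (adjacency_mat G vs)"
    using assms by (auto simp: spectrum_def eigenvalue_adjacency_mat_iff)
  thus ?thesis by (simp add: graph_spectral_radius_def)
qed

end

theory Submission
  imports Defs "HOL-Analysis.Function_Topology"
begin

text \<open>
  Write n = 2k and \<open>\<theta> = pi / (k + 1)\<close>. A minimum dominating set spanning as many arcs as possible is matched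
  by private neighbours with its complement, and minimality forces G to contain, as a spanning
  subgraph, the corona of a connected induced subgraph on a core C of k vertices.

  On C, root a spanning tree and let the value drop from a parent to a child by the factor
  \<open>sin (m \<theta>) / sin ((m + 1) \<theta>)\<close>, where m is the number of vertices below and including the child.
  For a path this is the sine eigenvector with eigenvalue \<open>2 cos \<theta>\<close>. This factor is strictly subadditive
  in m, so branching and extra arcs only increase the neighbour sums and the vector satisfies
  \<open>A f \<ge> 2 cos \<theta> f\<close>, with equality only on a path.

  Giving the pendant vertices the values \<open>f / \<mu>\<close>, where \<open>\<mu> - 1 / \<mu> = 2 cos \<theta>\<close>, yields a positive F with
  \<open>A F \<ge> \<mu> F\<close> on G. By the Rayleigh principle the largest eigenvalue is at least \<open>\<mu>\<close>, the value for the
  corona of the path, and equality forces \<open>A F = \<mu> F\<close>, hence G is that corona.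
\<close>

section \<open>Test vectors for the largest eigenvalue\<close>

text \<open>Row v of the adjacency operator restricted to S, so that induced subgraphs are handled
  inside the arc relation of the ambient graph. With S the whole vertex set it is the sum in
  \<open>eigenvalue_adjacency_mat_iff\<close>.\<close>

definition nbr_sum :: "('a \<times> 'a) set \<Rightarrow> 'a set \<Rightarrow> ('a \<Rightarrow> real) \<Rightarrow> 'a \<Rightarrow> real" where
  "nbr_sum E S f v = (\<Sum>u \<in> {u \<in> S. (v, u) \<in> E}. f u)"

lemma nbr_sum_alt:
  assumes "finite S"
  shows "nbr_sum E S f v = (\<Sum>u\<in>S. if (v, u) \<in> E then f u else 0)"
  unfolding nbr_sum_def by (rule sum.mono_neutral_cong_left) (use assms in auto)

lemma nbr_sum_cong: "(\<And>u. u \<in> S \<Longrightarrow> f u = g u) \<Longrightarrow> nbr_sum E S f v = nbr_sum E S g v"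
  unfolding nbr_sum_def by (rule sum.cong) auto

lemma nbr_sum_Un:
  assumes "finite A" "finite B" "A \<inter> B = {}"
  shows "nbr_sum E (A \<union> B) f v = nbr_sum E A f v + nbr_sum E B f v"
  using assms by (simp add: nbr_sum_alt sum.union_disjoint)

lemma nbr_sum_scale: "nbr_sum E S (\<lambda>u. c * f u) v = c * nbr_sum E S f v"
  by (simp add: nbr_sum_def sum_distrib_left)

lemma nbr_sum_nonneg: "(\<And>u. u \<in> S \<Longrightarrow> f u \<ge> 0) \<Longrightarrow> nbr_sum E S f v \<ge> 0"
  unfolding nbr_sum_def by (rule sum_nonneg) auto

lemma nbr_sum_eq_0_imp_no_arc:
  assumes "finite S" "\<And>u. u \<in> S \<Longrightarrow> f u > 0" "nbr_sum E S f v = 0" "u \<in> S"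
  shows "(v, u) \<notin> E"
proof
  assume "(v, u) \<in> E"
  with assms have "nbr_sum E S f v > 0"
    unfolding nbr_sum_def by (intro sum_pos) (auto)
  with assms show False by simp
qed

lemma nbr_sum_ge_member:
  assumes "finite S" "\<And>u. u \<in> S \<Longrightarrow> f u > 0" "s \<in> S" "(v, s) \<in> E"
  shows "nbr_sum E S f v \<ge> f s"
  unfolding nbr_sum_def using assms
  by (intro member_le_sum) (auto intro: less_imp_le)

lemma nbr_sum_eq_member_imp_unique:
  assumes "finite S" "\<And>u. u \<in> S \<Longrightarrow> f u > 0" "s \<in> S" "(v, s) \<in> E"
    and "nbr_sum E S f v = f s" "u \<in> S" "(v, u) \<in> E"
  shows "u = s"
proof (rule ccontr)
  assume "u \<noteq> s"
  have "nbr_sum E S f v = nbr_sum E (S - {s}) f v + nbr_sum E {s} f v"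
    using nbr_sum_Un[of "S - {s}" "{s}" E f v] assms by (simp add: insert_absorb)
  moreover have "nbr_sum E {s} f v = f s" using assms(1,4) by (simp add: nbr_sum_alt)
  ultimately have "nbr_sum E (S - {s}) f v = 0" using assms(5) by simp
  from nbr_sum_eq_0_imp_no_arc[OF _ _ this, of u] assms \<open>u \<noteq> s\<close> show False by auto
qed

text \<open>Vectors are functions on the whole type with the product topology. Pinning the
  coordinates outside V to 0 makes the sphere a closed part of a product of compact sets, which is
  compact by Tychonoff.\<close>

lemma compact_unit_sphere_fun:
  assumes "finite V"
  shows "compact {x :: 'a \<Rightarrow> real. (\<forall>v. v \<notin> V \<longrightarrow> x v = 0) \<and> (\<Sum>v\<in>V. (x v)\<^sup>2) = 1}"
    (is "compact ?K")
proof -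
  define B where "B v = (if v \<in> V then {-1..1::real} else {0})" for v
  have "compactin (product_topology (\<lambda>_. euclidean) UNIV) (PiE UNIV B)"
    unfolding compactin_PiE by (simp add: B_def)
  hence "compact (PiE UNIV B)"
    by (simp add: euclidean_product_topology)
  moreover have "closed {x :: 'a \<Rightarrow> real. (\<Sum>v\<in>V. (x v)\<^sup>2) = 1}"
    by (intro closed_Collect_eq continuous_intros continuous_on_product_coordinates)
  ultimately have "compact (PiE UNIV B \<inter> {x. (\<Sum>v\<in>V. (x v)\<^sup>2) = 1})"
    by (rule compact_Int_closed)
  moreover have "?K = PiE UNIV B \<inter> {x. (\<Sum>v\<in>V. (x v)\<^sup>2) = 1}"
  proof (intro Set.set_eqI iffI)
    fix x assume x: "x \<in> ?K"
    have "\<bar>x v\<bar> \<le> 1" if "v \<in> V" for v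
    proof -
      have "(x v)\<^sup>2 \<le> (\<Sum>v\<in>V. (x v)\<^sup>2)"
        by (rule member_le_sum) (use assms that in auto)
      thus ?thesis using x by (simp add: abs_square_le_1)
    qed
    with x show "x \<in> PiE UNIV B \<inter> {x. (\<Sum>v\<in>V. (x v)\<^sup>2) = 1}"
      by (auto simp: B_def abs_le_iff)
  next
    fix x assume "x \<in> PiE UNIV B \<inter> {x. (\<Sum>v\<in>V. (x v)\<^sup>2) = 1}"
    moreover have "x v = 0" if "x \<in> PiE UNIV B" "v \<notin> V" for v
      using PiE_mem[OF that(1), of v] that(2) by (simp add: B_def)
    ultimately show "x \<in> ?K" by auto
  qed
  ultimately show ?thesis by simp
qed

text \<open>For small t the linear term dominates: t = a / c with a positive c > b reduces the
  assumption to a^2 / c <= 0. This is the vanishing of the first variation at a maximum.\<close>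

lemma linear_le_quadratic_imp_zero:
  fixes a b :: real
  assumes "\<And>t. 2 * t * a \<le> t\<^sup>2 * b"
  shows "a = 0"
proof (rule ccontr)
  assume a: "a \<noteq> 0"
  define c where "c = \<bar>b\<bar> + 1"
  have c: "c > 0" "b < c" by (auto simp: c_def)
  have "2 * (a / c) * a \<le> (a / c)\<^sup>2 * b" by (rule assms)
  also have "\<dots> \<le> (a / c)\<^sup>2 * c" using c by (intro mult_left_mono) auto
  also have "\<dots> = (a / c) * a" using c by (simp add: power2_eq_square)
  finally have "a * a / c \<le> 0" by simp
  moreover have "a * a / c > 0" using a c by (intro divide_pos_pos) (auto simp: zero_less_mult_iff linorder_neq_iff)
  ultimately show False by simp
qed

text \<open>A maximiser of the quadratic form on the unit sphere is an eigenvector, because the first variation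
  vanishes there.\<close>

lemma rayleigh_eigenvector:
  fixes V :: "'a set" and E :: "('a \<times> 'a) set"
  assumes fin: "finite V" and ne: "V \<noteq> {}" and sym: "sym E"
  shows "\<exists>x m. (\<exists>v\<in>V. x v \<noteq> 0) \<and> (\<forall>v\<in>V. nbr_sum E V x v = m * x v) \<and>
    (\<forall>f. (\<Sum>v\<in>V. f v * nbr_sum E V f v) \<le> m * (\<Sum>v\<in>V. (f v)\<^sup>2))"
proof -
  define B where "B f g = (\<Sum>v\<in>V. f v * nbr_sum E V g v)" for f g :: "'a \<Rightarrow> real"
  define K where "K = {x :: 'a \<Rightarrow> real. (\<forall>v. v \<notin> V \<longrightarrow> x v = 0) \<and> (\<Sum>v\<in>V. (x v)\<^sup>2) = 1}"
  have B_alt: "B f g = (\<Sum>v\<in>V. \<Sum>u\<in>V. if (v, u) \<in> E then f v * g u else 0)" for f g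
    unfolding B_def nbr_sum_alt[OF fin] sum_distrib_left by (intro sum.cong) auto
  have B_comm: "B f g = B g f" for f g
  proof -
    have "B f g = (\<Sum>u\<in>V. \<Sum>v\<in>V. if (v, u) \<in> E then f v * g u else 0)"
      unfolding B_alt by (rule sum.swap)
    also have "\<dots> = B g f"
      unfolding B_alt using sym by (intro sum.cong refl) (auto simp: mult.commute dest: symD)
    finally show ?thesis .
  qed
  have B_add: "B f (\<lambda>v. g v + t * h v) = B f g + t * B f h" for f g h t
    unfolding B_alt sum_distrib_left sum.distrib[symmetric]
    by (intro sum.cong refl) (auto simp: algebra_simps)
  obtain w where w: "w \<in> V" using ne by blast
  \<comment> \<open>The indicator of one vertex shows that the sphere is inhabited, so that the
    maximum is attained.\<close>
  have "(\<lambda>v. if v = w then 1 else 0) \<in> K"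
    using w fin by (auto simp: K_def if_distrib[of "\<lambda>y. y\<^sup>2"] cong: if_cong)
  moreover have "compact K" unfolding K_def by (rule compact_unit_sphere_fun[OF fin])
  moreover have "continuous_on K (\<lambda>x. B x x)"
  proof -
    have c: "continuous_on K (\<lambda>x :: 'a \<Rightarrow> real. x v)" for v
      by (rule continuous_on_subset[OF continuous_on_product_coordinates]) simp
    have "continuous_on K (\<lambda>x. \<Sum>v\<in>V. x v * (\<Sum>u\<in>{u\<in>V. (v, u) \<in> E}. x u))"
      by (intro continuous_on_sum continuous_on_mult c)
    thus ?thesis by (simp add: B_def nbr_sum_def)
  qed
  ultimately obtain x where x: "x \<in> K" "\<And>y. y \<in> K \<Longrightarrow> B y y \<le> B x x"
    using continuous_attains_sup[of K "\<lambda>x. B x x"] by blast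
  define m where "m = B x x"
  have max: "B f f \<le> m * (\<Sum>v\<in>V. (f v)\<^sup>2)" for f
  proof (cases "(\<Sum>v\<in>V. (f v)\<^sup>2) = 0")
    case True
    hence "\<And>v. v \<in> V \<Longrightarrow> f v = 0" using fin by (simp add: sum_nonneg_eq_0_iff)
    thus ?thesis using True by (simp add: B_def)
  next
    case False
    define s where "s = (\<Sum>v\<in>V. (f v)\<^sup>2)"
    have s: "s > 0" using False sum_nonneg[of V "\<lambda>v. (f v)\<^sup>2"] by (auto simp: s_def less_le)
    define y where "y v = (if v \<in> V then (1 / sqrt s) * f v else 0)" for v
    have "(\<Sum>v\<in>V. (y v)\<^sup>2) = (\<Sum>v\<in>V. (1 / s) * (f v)\<^sup>2)"
      using s by (intro sum.cong) (auto simp: y_def power_divide)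
    also have "\<dots> = 1" unfolding sum_distrib_left[symmetric] using s by (simp add: s_def)
    finally have "y \<in> K" by (simp add: K_def y_def)
    hence "B y y \<le> m" using x by (simp add: m_def)
    moreover have "B y y = (1 / s) * B f f"
      unfolding B_alt sum_distrib_left using s
      by (intro sum.cong refl) (auto simp: y_def)
    ultimately show ?thesis using s by (simp add: s_def[symmetric] field_simps)
  qed
  have nx: "(\<Sum>v\<in>V. (x v)\<^sup>2) = 1" using x by (simp add: K_def)
  have "nbr_sum E V x v = m * x v" if v: "v \<in> V" for v
  proof -
    \<comment> \<open>The variation goes in the direction of the unit vector at v. Expanding the
      bound \<open>max\<close> at x + t z leaves exactly the hypothesis of
      \<open>linear_le_quadratic_imp_zero\<close>.\<close>
    define z where "z u = (if u = v then 1 else 0 :: real)" for u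
    have Bzx: "B z x = nbr_sum E V x v"
      using fin v by (simp add: B_def z_def if_distrib[of "\<lambda>y. y * _"] cong: if_cong)
    have "2 * t * (B z x - m * x v) \<le> t\<^sup>2 * (m - B z z)" for t
    proof -
      define y where "y u = x u + t * z u" for u
      have "B y y = B x x + 2 * t * B z x + t\<^sup>2 * B z z"
        unfolding y_def B_add B_comm[of "\<lambda>v. x v + t * z v"]
        using B_comm[of x z] by (simp add: algebra_simps power2_eq_square)
      moreover have "(\<Sum>u\<in>V. (y u)\<^sup>2) = (\<Sum>u\<in>V. (x u)\<^sup>2 + (if u = v then 2 * t * x v + t\<^sup>2 else 0))"
        by (intro sum.cong) (auto simp: y_def z_def power2_eq_square algebra_simps)
      hence "(\<Sum>u\<in>V. (y u)\<^sup>2) = 1 + (2 * t * x v + t\<^sup>2)"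
        using fin v nx by (simp add: sum.distrib)
      ultimately show ?thesis using max[of y] by (simp add: m_def algebra_simps)
    qed
    from linear_le_quadratic_imp_zero[OF this] show ?thesis by (simp add: Bzx)
  qed
  moreover have "\<exists>v\<in>V. x v \<noteq> 0"
  proof (rule ccontr)
    assume "\<not> ?thesis"
    thus False using nx by simp
  qed
  ultimately show ?thesis using max unfolding B_def by blast
qed

section \<open>Comparing the spectral radius with positive test vectors\<close>

lemma pair_graph_enum:
  assumes "pair_graph G"
  obtains vs where "distinct vs" "set vs = pverts G"
    "finite (spectrum (adjacency_mat G vs))"
    "graph_spectral_radius G = Max (spectrum (adjacency_mat G vs))"
proof -
  interpret pair_graph G by (rule assms)
  obtain vs where vs: "distinct vs" "set vs = pverts G"
    using finite_distinct_list[OF pair_finite_verts] by blast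
  moreover have "finite (spectrum (adjacency_mat G vs))"
    by (rule card_finite_spectrum(1)[of _ "length vs"]) (simp add: adjacency_mat_def)
  ultimately show thesis using that graph_spectral_radius_eq by blast
qed

lemma pair_graph_sym: "pair_graph G \<Longrightarrow> sym (parcs G)"
proof -
  assume "pair_graph G"
  then interpret pair_graph G .
  show ?thesis using pair_sym_arcs by (simp add: symmetric_def)
qed

lemma pair_graph_finite: "pair_graph G \<Longrightarrow> finite (pverts G)"
proof -
  assume "pair_graph G"
  then interpret pair_graph G .
  show ?thesis by (rule pair_finite_verts)
qed

text \<open>Pairing the inequality with f gives \<open>\<mu>\<close> <f, f> <= <f, A f> <= m <f, f>,
  where the eigenvalue m is the maximum of the Rayleigh quotient. As f is positive, strictness at a
  single vertex would survive in the sum, so m = \<open>\<mu>\<close> forces equality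
  everywhere.\<close>

lemma subinvariant_vector_le_spectral_radius:
  assumes G: "pair_graph G" and ne: "pverts G \<noteq> {}"
    and pos: "\<And>v. v \<in> pverts G \<Longrightarrow> f v > 0"
    and sub: "\<And>v. v \<in> pverts G \<Longrightarrow> \<mu> * f v \<le> nbr_sum (parcs G) (pverts G) f v"
  shows "\<mu> \<le> graph_spectral_radius G"
    and "graph_spectral_radius G = \<mu> \<Longrightarrow> v \<in> pverts G \<Longrightarrow>
      nbr_sum (parcs G) (pverts G) f v = \<mu> * f v"
proof -
  let ?V = "pverts G" and ?N = "nbr_sum (parcs G) (pverts G)"
  have fin: "finite ?V" by (rule pair_graph_finite[OF G])
  obtain vs where vs: "distinct vs" "set vs = ?V" "finite (spectrum (adjacency_mat G vs))"
    "graph_spectral_radius G = Max (spectrum (adjacency_mat G vs))"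
    using pair_graph_enum[OF G] .
  obtain x m where x: "\<exists>v\<in>?V. x v \<noteq> 0" "\<And>v. v \<in> ?V \<Longrightarrow> ?N x v = m * x v"
    and max: "\<And>f. (\<Sum>v\<in>?V. f v * ?N f v) \<le> m * (\<Sum>v\<in>?V. (f v)\<^sup>2)"
    using rayleigh_eigenvector[OF fin ne pair_graph_sym[OF G]] by blast
  have "eigenvalue (adjacency_mat G vs) m"
    unfolding eigenvalue_adjacency_mat_iff[OF vs(1)] vs(2)
    using x unfolding nbr_sum_def by blast
  hence m: "m \<le> graph_spectral_radius G"
    using vs(3,4) by (simp add: spectrum_def)
  have sq: "(\<Sum>v\<in>?V. (f v)\<^sup>2) > 0"
    using fin ne pos by (intro sum_pos zero_less_power) auto
  have le: "\<mu> * (f v)\<^sup>2 \<le> f v * ?N f v" if "v \<in> ?V" for v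
    using mult_left_mono[OF sub[OF that], of "f v"] pos[OF that]
    by (simp add: power2_eq_square algebra_simps)
  have le': "\<mu> * (\<Sum>v\<in>?V. (f v)\<^sup>2) \<le> (\<Sum>v\<in>?V. f v * ?N f v)"
    unfolding sum_distrib_left by (intro sum_mono le)
  have "\<mu> * (\<Sum>v\<in>?V. (f v)\<^sup>2) \<le> m * (\<Sum>v\<in>?V. (f v)\<^sup>2)"
    using le' max[of f] by linarith
  hence "\<mu> \<le> m" using sq by simp
  thus "\<mu> \<le> graph_spectral_radius G" using m by simp
  assume eq: "graph_spectral_radius G = \<mu>" and v: "v \<in> ?V"
  with m \<open>\<mu> \<le> m\<close> have "m = \<mu>" by simp
  show "?N f v = \<mu> * f v"
  proof (rule ccontr)
    assume "?N f v \<noteq> \<mu> * f v"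
    with sub[OF v] have "\<mu> * f v < ?N f v" by simp
    hence "\<mu> * (f v)\<^sup>2 < f v * ?N f v"
      using mult_strict_left_mono[of "\<mu> * f v" "?N f v" "f v"] pos[OF v]
      by (simp add: power2_eq_square algebra_simps)
    hence "(\<Sum>v\<in>?V. \<mu> * (f v)\<^sup>2) < (\<Sum>v\<in>?V. f v * ?N f v)"
      using le v fin by (intro sum_strict_mono_ex1) auto
    thus False using max[of f] \<open>m = \<mu>\<close> by (simp add: sum_distrib_left)
  qed
qed

text \<open>An eigenvector g for any eigenvalue k is compared with f at a vertex w where |g| / f is
  maximal: there k |g w| is at most the neighbour sum of |g|, hence at most that of
  \<open>r w * f\<close>, which is \<open>\<mu>\<close> |g w|. So no eigenvalue exceeds
  \<open>\<mu>\<close>.\<close>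

lemma spectral_radius_eq_positive_eigenvector:
  assumes G: "pair_graph G" and ne: "pverts G \<noteq> {}"
    and pos: "\<And>v. v \<in> pverts G \<Longrightarrow> f v > 0"
    and eig: "\<And>v. v \<in> pverts G \<Longrightarrow> nbr_sum (parcs G) (pverts G) f v = \<mu> * f v"
  shows "graph_spectral_radius G = \<mu>"
proof (rule antisym)
  let ?V = "pverts G" and ?N = "nbr_sum (parcs G) (pverts G)"
  show "\<mu> \<le> graph_spectral_radius G"
    by (rule subinvariant_vector_le_spectral_radius(1)[OF G ne, of f]) (use pos eig in auto)
  have fin: "finite ?V" by (rule pair_graph_finite[OF G])
  obtain vs where vs: "distinct vs" "set vs = ?V" "finite (spectrum (adjacency_mat G vs))"
    "graph_spectral_radius G = Max (spectrum (adjacency_mat G vs))"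
    using pair_graph_enum[OF G] .
  have "k \<le> \<mu>" if k: "eigenvalue (adjacency_mat G vs) k" for k
  proof -
    from k obtain g where g: "\<exists>v\<in>?V. g v \<noteq> 0" "\<And>v. v \<in> ?V \<Longrightarrow> ?N g v = k * g v"
      unfolding eigenvalue_adjacency_mat_iff[OF vs(1)] vs(2) nbr_sum_def by blast
    define r where "r v = \<bar>g v\<bar> / f v" for v
    have "Max (r ` ?V) \<in> r ` ?V" using fin ne by (intro Max_in) auto
    then obtain w where w: "w \<in> ?V" "r w = Max (r ` ?V)" by force
    have rw: "r v \<le> r w" if "v \<in> ?V" for v using that fin by (simp add: w(2))
    obtain v0 where v0: "v0 \<in> ?V" "g v0 \<noteq> 0" using g by blast
    hence "r v0 > 0" using pos by (simp add: r_def)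
    hence r0: "r w > 0" using rw[OF v0(1)] by simp
    have "k * (r w * f w) \<le> \<bar>k * g w\<bar>" using pos[OF w(1)] by (auto simp: r_def abs_mult mult_right_mono)
    also have "\<dots> = \<bar>?N g w\<bar>" using g w by simp
    also have "\<dots> \<le> ?N (\<lambda>u. \<bar>g u\<bar>) w" unfolding nbr_sum_def by (rule sum_abs)
    also have "\<dots> \<le> ?N (\<lambda>u. r w * f u) w"
      unfolding nbr_sum_def
    proof (rule sum_mono)
      fix u assume "u \<in> {u \<in> ?V. (w, u) \<in> parcs G}"
      hence u: "u \<in> ?V" by simp
      show "\<bar>g u\<bar> \<le> r w * f u" using rw[OF u] pos[OF u] by (simp add: r_def[of u] field_simps)
    qed
    also have "\<dots> = \<mu> * (r w * f w)" using w eig by (simp add: nbr_sum_scale)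
    finally show ?thesis using r0 pos[OF w(1)] by simp
  qed
  moreover have "eigenvalue (adjacency_mat G vs) \<mu>"
    unfolding eigenvalue_adjacency_mat_iff[OF vs(1)] vs(2)
    using ne pos eig unfolding nbr_sum_def by (metis all_not_in_conv less_irrefl)
  ultimately show "graph_spectral_radius G \<le> \<mu>"
    unfolding vs(4) using vs(3) by (intro Max.boundedI) (auto simp: spectrum_def)
qed

section \<open>Test vectors on connected graphs\<close>

text \<open>Connectivity is phrased by cuts because this is the form in which trees are grown: any
  proper nonempty part of S can be extended by an arc. It also applies to a vertex subset without
  forming the subgraph.\<close>

definition cut_connected :: "('a \<times> 'a) set \<Rightarrow> 'a set \<Rightarrow> bool" where
  "cut_connected E S \<longleftrightarrow>
     (\<forall>T \<subseteq> S. T \<noteq> {} \<longrightarrow> T \<noteq> S \<longrightarrow> (\<exists>u \<in> T. \<exists>v \<in> S - T. (u, v) \<in> E))"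

text \<open>\<open>rtree E A r\<close>: A has a spanning tree rooted at r with arcs in E; further arcs of E inside A are
  allowed.\<close>

inductive rtree :: "('a \<times> 'a) set \<Rightarrow> 'a set \<Rightarrow> 'a \<Rightarrow> bool" for E where
  single: "rtree E {r} r"
| join: "rtree E A r \<Longrightarrow> rtree E B s \<Longrightarrow> A \<inter> B = {} \<Longrightarrow> (r, s) \<in> E \<Longrightarrow> rtree E (A \<union> B) r"

lemma rtree_root: "rtree E A r \<Longrightarrow> r \<in> A"
  by (induction rule: rtree.induct) auto

lemma rtree_finite: "rtree E A r \<Longrightarrow> finite A"
  by (induction rule: rtree.induct) auto

text \<open>The rule \<open>join\<close> attaches a branch at the root only. To attach it at an
  arbitrary vertex u, the induction descends into the half that contains u.\<close>

lemma rtree_graft: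
  assumes "rtree E A r" "rtree E B s" "u \<in> A" "(u, s) \<in> E" "A \<inter> B = {}"
  shows "rtree E (A \<union> B) r"
  using assms
proof (induction rule: rtree.induct)
  case (single r)
  thus ?case by (intro rtree.join[OF rtree.single]) auto
next
  case (join A r A' r')
  show ?case
  proof (cases "u \<in> A")
    case True
    have "rtree E ((A \<union> B) \<union> A') r"
      using join True by (intro rtree.join[OF _ join.hyps(2)]) auto
    thus ?thesis by (simp add: Un_ac)
  next
    case False
    have "rtree E (A \<union> (A' \<union> B)) r"
      using join False by (intro rtree.join[OF join.hyps(1)]) auto
    thus ?thesis by (simp add: Un_ac)
  qed
qed

text \<open>Of the two halves of a join, the one containing s is rerooted at s, and the other is
  grafted onto it along the joining arc, reversed if necessary.\<close>

lemma rtree_reroot: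
  assumes "rtree E A r" "sym E" "s \<in> A"
  shows "rtree E A s"
  using assms
proof (induction arbitrary: s rule: rtree.induct)
  case (single r)
  thus ?case by (auto intro: rtree.single)
next
  case (join A r B r')
  show ?case
  proof (cases "s \<in> A")
    case True
    thus ?thesis using join by (intro rtree_graft[of E A s B r' r]) (auto intro: rtree_root)
  next
    case False
    hence "rtree E (B \<union> A) s"
      using join by (intro rtree_graft[of E B s A r r']) (auto intro: rtree_root dest: symD)
    thus ?thesis by (simp add: Un_commute)
  qed
qed

lemma cut_connected_rtree_of_card:
  assumes "cut_connected E S" "finite S" "r \<in> S" "1 \<le> j" "j \<le> card S"
  shows "\<exists>T \<subseteq> S. card T = j \<and> rtree E T r"
  using assms(4,5)
proof (induction j rule: nat_induct_at_least)
  case base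
  show ?case using assms(3) by (intro exI[of _ "{r}"]) (auto intro: rtree.single)
next
  case (Suc j)
  then obtain T where T: "T \<subseteq> S" "card T = j" "rtree E T r" by auto
  from Suc T have "T \<noteq> S" "T \<noteq> {}" by auto
  with assms(1) T obtain u v where uv: "u \<in> T" "v \<in> S - T" "(u, v) \<in> E"
    unfolding cut_connected_def by blast
  have "rtree E (T \<union> {v}) r"
    using uv T by (intro rtree_graft[OF T(3) rtree.single]) auto
  moreover have "card (T \<union> {v}) = Suc j"
    using uv T rtree_finite[OF T(3)] by simp
  ultimately show ?case using uv T by (intro exI[of _ "T \<union> {v}"]) auto
qed

text \<open>A tree is grown until a single vertex w is left; the cut around it supplies an arc to w,
  and the tree is rerooted at the other end of that arc. Taking w as root with a single branch later
  avoids subadditivity at the full order of the core, where the angle reaches pi.\<close>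

lemma cut_connected_leaf_rtree:
  assumes "cut_connected E S" "finite S" "card S \<ge> 2" "sym E"
  obtains w s where "w \<in> S" "rtree E (S - {w}) s" "(w, s) \<in> E"
proof -
  from assms(3) have "S \<noteq> {}" by auto
  then obtain r where r: "r \<in> S" by blast
  obtain T where T: "T \<subseteq> S" "card T = card S - 1" "rtree E T r"
    using cut_connected_rtree_of_card[OF assms(1,2) r, of "card S - 1"] assms(3) by force
  have "card (S - T) = 1"
    using T assms by (simp add: card_Diff_subset rtree_finite)
  then obtain w where "S - T = {w}" by (auto simp: card_1_singleton_iff)
  with T have w: "w \<in> S" "T = S - {w}" by auto
  have "T \<noteq> {}" "T \<noteq> S" using rtree_root[OF T(3)] w by auto
  with assms(1) T obtain u v where uv: "u \<in> T" "v \<in> S - T" "(u, v) \<in> E"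
    unfolding cut_connected_def by blast
  with w have "v = w" by auto
  moreover have "rtree E T u" by (rule rtree_reroot) (use T assms uv in auto)
  ultimately show thesis using that w uv assms(4) by (metis symD)
qed

section \<open>Quotients of consecutive entries of the sine eigenvector of a path\<close>

definition sin_ratio :: "real \<Rightarrow> nat \<Rightarrow> real" where
  "sin_ratio \<theta> j = sin (real j * \<theta>) / sin (real (Suc j) * \<theta>)"

lemma sin_mult_pos:
  assumes "0 < \<theta>" "real m * \<theta> < pi" "0 < j" "j \<le> m"
  shows "sin (real j * \<theta>) > 0"
proof (rule sin_gt_zero)
  show "0 < real j * \<theta>" using assms by simp
  have "real j * \<theta> \<le> real m * \<theta>" using assms by (intro mult_right_mono) auto
  thus "real j * \<theta> < pi" using assms(2) by linarith
qed

lemma sin_ratio_0 [simp]: "sin_ratio \<theta> 0 = 0"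
  by (simp add: sin_ratio_def)

lemma sin_ratio_pos:
  assumes "0 < \<theta>" "real (Suc j) * \<theta> < pi" "0 < j"
  shows "sin_ratio \<theta> j > 0"
  unfolding sin_ratio_def using assms
  by (intro divide_pos_pos sin_mult_pos[of \<theta> "Suc j"]) auto

lemma sin_three_term: "sin (x - t) + sin (x + t) = 2 * cos t * sin (x :: real)"
  by (simp add: sin_add sin_diff)

text \<open>The eigenvalue equation at an inner vertex of a path, divided by its own entry: the
  first term is the child, the second the parent.\<close>

lemma sin_ratio_continued_fraction:
  assumes "0 < \<theta>" "real (Suc (Suc j)) * \<theta> < pi"
  shows "sin_ratio \<theta> j + 1 / sin_ratio \<theta> (Suc j) = 2 * cos \<theta>"
proof -
  have pos: "sin (real (Suc j) * \<theta>) > 0"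
    by (rule sin_mult_pos[OF assms]) auto
  have "sin_ratio \<theta> j + 1 / sin_ratio \<theta> (Suc j) =
      (sin (real (Suc j) * \<theta> - \<theta>) + sin (real (Suc j) * \<theta> + \<theta>)) / sin (real (Suc j) * \<theta>)"
    by (simp add: sin_ratio_def add_divide_distrib algebra_simps)
  also have "\<dots> = 2 * cos \<theta>" using pos by (simp add: sin_three_term)
  finally show ?thesis .
qed

lemma angle_pos: "real (k + 1) * \<theta> = pi \<Longrightarrow> \<theta> > 0"
  using pi_gt_zero by (metis of_nat_0_le_iff zero_less_mult_pos less_le mult_zero_left)

text \<open>Since sin ((k + 1) \<open>\<theta>\<close>) = 0, the last vertex of a path of order k
  has no parent term to make up for: its single neighbour already yields the full
  eigenvalue.\<close>

lemma sin_ratio_last: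
  assumes "real (k + 1) * \<theta> = pi" "k \<ge> 1"
  shows "sin_ratio \<theta> (k - 1) = 2 * cos \<theta>"
proof -
  have \<theta>: "\<theta> > 0" by (rule angle_pos[OF assms(1)])
  have k: "real k * \<theta> < pi" using assms(1) \<theta> by (simp add: algebra_simps)
  have "sin (real k * \<theta>) > 0" by (rule sin_mult_pos[OF \<theta> k]) (use assms in auto)
  moreover have "sin (real k * \<theta> - \<theta>) + sin (real k * \<theta> + \<theta>) = 2 * cos \<theta> * sin (real k * \<theta>)"
    by (rule sin_three_term)
  moreover have "real k * \<theta> + \<theta> = pi" "real k * \<theta> - \<theta> = real (k - 1) * \<theta>"
    using assms by (simp_all add: algebra_simps of_nat_diff)
  ultimately show ?thesis using assms(2) by (simp add: sin_ratio_def field_simps)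
qed

text \<open>The left side is 2 cos \<open>\<theta>\<close> - sin (\<open>\<alpha>\<close> +
  \<open>\<beta>\<close>) / sin \<open>\<gamma>\<close>, and the right side is 2 cos
  \<open>\<theta>\<close> - sin \<open>\<theta>\<close> sin (\<open>\<alpha>\<close> +
  \<open>\<beta>\<close>) / (sin \<open>\<alpha>\<close> sin \<open>\<beta>\<close>). So the claim
  is sin \<open>\<theta>\<close> sin \<open>\<gamma>\<close> < sin \<open>\<alpha>\<close> sin
  \<open>\<beta>\<close>, and the difference of these products is sin (a \<open>\<theta>\<close>)
  sin (b \<open>\<theta>\<close>) > 0.\<close>

lemma sin_ratio_strict_subadditive:
  assumes \<theta>: "0 < \<theta>" and less: "real (a + b + 2) * \<theta> < pi" and ab: "0 < a" "0 < b"
  shows "sin_ratio \<theta> (a + b) < sin_ratio \<theta> a + sin_ratio \<theta> b"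
proof -
  define \<alpha> \<beta> \<gamma> where "\<alpha> = real (Suc a) * \<theta>" and "\<beta> = real (Suc b) * \<theta>"
    and "\<gamma> = real (Suc (a + b)) * \<theta>"
  have pos: "sin \<alpha> > 0" "sin \<beta> > 0" "sin \<gamma> > 0" "sin (\<alpha> + \<beta>) > 0" "sin (\<alpha> - \<theta>) > 0" "sin (\<beta> - \<theta>) > 0"
    using sin_mult_pos[OF \<theta> less, of "Suc a"] sin_mult_pos[OF \<theta> less, of "Suc b"]
      sin_mult_pos[OF \<theta> less, of "Suc (a + b)"] sin_mult_pos[OF \<theta> less, of "a + b + 2"]
      sin_mult_pos[OF \<theta> less, of a] sin_mult_pos[OF \<theta> less, of b] ab
    by (simp_all add: \<alpha>_def \<beta>_def \<gamma>_def algebra_simps)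
  have \<gamma>: "\<gamma> + \<theta> = \<alpha> + \<beta>" by (simp add: \<alpha>_def \<beta>_def \<gamma>_def algebra_simps)
  have "sin \<alpha> * sin \<beta> - sin \<theta> * sin \<gamma> = sin (\<alpha> - \<theta>) * sin (\<beta> - \<theta>)"
  proof -
    have "\<gamma> = \<alpha> + \<beta> - \<theta>" using \<gamma> by simp
    hence e: "sin \<gamma> = (sin \<alpha> * cos \<beta> + cos \<alpha> * sin \<beta>) * cos \<theta> -
        (cos \<alpha> * cos \<beta> - sin \<alpha> * sin \<beta>) * sin \<theta>"
      by (simp only: sin_diff sin_add cos_add)
    have "sin \<alpha> * sin \<beta> - sin \<theta> * sin \<gamma> - sin (\<alpha> - \<theta>) * sin (\<beta> - \<theta>) =
        sin \<alpha> * sin \<beta> * (1 - ((sin \<theta>)\<^sup>2 + (cos \<theta>)\<^sup>2))"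
      unfolding e sin_diff power2_eq_square by (simp only: algebra_simps)
    thus ?thesis by (simp only: sin_cos_squared_add) simp
  qed
  also have "\<dots> > 0" using pos by simp
  finally have key: "sin \<theta> * sin \<gamma> < sin \<alpha> * sin \<beta>" by simp
  have "sin_ratio \<theta> (a + b) = sin (\<gamma> - \<theta>) / sin \<gamma>"
    by (simp add: sin_ratio_def \<gamma>_def algebra_simps)
  also have "sin (\<gamma> - \<theta>) = 2 * cos \<theta> * sin \<gamma> - sin (\<alpha> + \<beta>)"
    using sin_three_term[of \<gamma> \<theta>] \<gamma> by simp
  also have "\<dots> / sin \<gamma> = 2 * cos \<theta> - sin (\<alpha> + \<beta>) / sin \<gamma>"
    using pos by (simp add: field_simps)
  also have "\<dots> < 2 * cos \<theta> - sin \<theta> * sin (\<alpha> + \<beta>) / (sin \<alpha> * sin \<beta>)"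
  proof -
    have "sin (\<alpha> + \<beta>) * (sin \<theta> * sin \<gamma>) < sin (\<alpha> + \<beta>) * (sin \<alpha> * sin \<beta>)"
      using key pos by (intro mult_strict_left_mono)
    thus ?thesis using pos by (simp add: field_simps)
  qed
  also have "\<dots> = sin (\<alpha> - \<theta>) / sin \<alpha> + sin (\<beta> - \<theta>) / sin \<beta>"
    using pos by (simp add: sin_diff sin_add field_simps)
  also have "\<dots> = sin_ratio \<theta> a + sin_ratio \<theta> b"
    by (simp add: sin_ratio_def \<alpha>_def \<beta>_def algebra_simps)
  finally show ?thesis .
qed

text \<open>At the root r the term of the parent is missing, so the bound \<open>2 * cos \<theta>\<close> is replaced by the value
  attained by a path of the same order: there \<open>sin_ratio\<close> is the quotient of consecutive entries of
  the sine eigenvector.\<close>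

definition branch_test :: "('a \<times> 'a) set \<Rightarrow> real \<Rightarrow> 'a set \<Rightarrow> 'a \<Rightarrow> ('a \<Rightarrow> real) \<Rightarrow> bool" where
  "branch_test E \<theta> C r f \<longleftrightarrow> (\<forall>v\<in>C. f v > 0) \<and>
     (\<forall>v\<in>C - {r}. 2 * cos \<theta> * f v \<le> nbr_sum E C f v) \<and>
     sin_ratio \<theta> (card C - 1) * f r \<le> nbr_sum E C f r"

definition branch_tight :: "('a \<times> 'a) set \<Rightarrow> real \<Rightarrow> 'a set \<Rightarrow> 'a \<Rightarrow> ('a \<Rightarrow> real) \<Rightarrow> bool" where
  "branch_tight E \<theta> C r f \<longleftrightarrow>
     (\<forall>v\<in>C - {r}. nbr_sum E C f v = 2 * cos \<theta> * f v) \<and>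
     nbr_sum E C f r = sin_ratio \<theta> (card C - 1) * f r"

section \<open>Induced paths and the gluing of branches\<close>

definition induced_path :: "('a \<times> 'a) set \<Rightarrow> 'a set \<Rightarrow> 'a list \<Rightarrow> bool" where
  "induced_path E C xs \<longleftrightarrow> distinct xs \<and> set xs = C \<and>
     (\<forall>i < length xs. \<forall>j < length xs. (xs ! i, xs ! j) \<in> E \<longleftrightarrow> j = Suc i \<or> i = Suc j)"

lemma induced_path_single: "(r, r) \<notin> E \<Longrightarrow> induced_path E {r} [r]"
  by (simp add: induced_path_def)

lemma induced_path_Cons:
  assumes path: "induced_path E B xs" and "hd xs = s" "r \<notin> B" "sym E" "(r, r) \<notin> E" "B \<noteq> {}"
    and nbr: "\<And>u. u \<in> B \<Longrightarrow> (r, u) \<in> E \<longleftrightarrow> u = s"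
  shows "induced_path E (insert r B) (r # xs)"
proof -
  have ne: "xs \<noteq> []" using assms by (auto simp: induced_path_def)
  hence s: "xs ! 0 = s" using assms(2) by (simp add: hd_conv_nth)
  have d: "distinct xs" "set xs = B" using path by (auto simp: induced_path_def)
  have *: "(r, xs ! j) \<in> E \<longleftrightarrow> j = 0" if "j < length xs" for j
  proof -
    have "(r, xs ! j) \<in> E \<longleftrightarrow> xs ! j = xs ! 0" using nbr[OF nth_mem[OF that, unfolded d(2)]] s by simp
    also have "\<dots> \<longleftrightarrow> j = 0" using d that ne by (simp add: nth_eq_iff_index_eq)
    finally show ?thesis .
  qed
  have **: "(xs ! j, r) \<in> E \<longleftrightarrow> j = 0" if "j < length xs" for j
    using *[OF that] assms(4) by (metis symD)
  show ?thesis
    unfolding induced_path_def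
  proof (intro conjI allI impI)
    fix i j assume "i < length (r # xs)" "j < length (r # xs)"
    thus "((r # xs) ! i, (r # xs) ! j) \<in> E \<longleftrightarrow> j = Suc i \<or> i = Suc j"
      using * ** assms(5) path by (cases i; cases j) (auto simp: induced_path_def)
  qed (use d assms(3) in auto)
qed

text \<open>The vector f is kept on A and g is rescaled on B. At s the parent r supplies what
  \<open>sin_ratio_continued_fraction\<close> demands; at r subadditivity of
  \<open>sin_ratio\<close> gives the bound for the larger order. It is strict as soon as A has a
  second vertex, so equality leaves only r on top of B. Strictness needs an angle below pi, which is
  what \<open>cases\<close> provides.\<close>

lemma branch_join:
  assumes symE: "sym E" and fin: "finite A" "finite B" and disj: "A \<inter> B = {}"
    and r: "r \<in> A" and s: "s \<in> B" and rs: "(r, s) \<in> E"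
    and f: "branch_test E \<theta> A r f" and g: "branch_test E \<theta> B s g"
    and \<theta>: "0 < \<theta>" "real (card B + 1) * \<theta> < pi"
    and cases: "A = {r} \<or> real (card A + card B + 1) * \<theta> < pi"
  shows "\<exists>h. branch_test E \<theta> (A \<union> B) r h \<and>
    (branch_tight E \<theta> (A \<union> B) r h \<longrightarrow>
      A = {r} \<and> (\<forall>u\<in>B. (r, u) \<in> E \<longleftrightarrow> u = s) \<and> branch_tight E \<theta> B s g)"
proof -
  \<comment> \<open>The root r is not counted in a, whereas s is counted in b: these are the numbers
    of vertices below r in the two parts, and they add up to
    \<open>card (A \<union> B) - 1\<close>.\<close>
  define a b where "a = card A - 1" and "b = card B"
  have cA: "card A = Suc a" using r fin by (cases "card A") (auto simp: a_def)
  have b: "b > 0" using s fin by (auto simp: b_def card_gt_0_iff)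
  have \<rho>b: "sin_ratio \<theta> b > 0" using \<theta> b by (intro sin_ratio_pos) (auto simp: b_def)
  have cf: "sin_ratio \<theta> (b - 1) + 1 / sin_ratio \<theta> b = 2 * cos \<theta>"
    using sin_ratio_continued_fraction[of \<theta> "b - 1"] \<theta> b by (simp add: b_def)
  have cAB: "card (A \<union> B) - 1 = a + b"
    using fin disj cA by (simp add: card_Un_disjoint b_def)
  have fpos: "\<And>v. v \<in> A \<Longrightarrow> f v > 0" and gpos: "\<And>v. v \<in> B \<Longrightarrow> g v > 0"
    using f g by (auto simp: branch_test_def)
  have super: "sin_ratio \<theta> (a + b) \<le> sin_ratio \<theta> a + sin_ratio \<theta> b"
    and strict: "A \<noteq> {r} \<Longrightarrow> sin_ratio \<theta> (a + b) < sin_ratio \<theta> a + sin_ratio \<theta> b"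
  proof -
    show strict: "sin_ratio \<theta> (a + b) < sin_ratio \<theta> a + sin_ratio \<theta> b" if "A \<noteq> {r}"
    proof -
      have "a \<noteq> 0"
      proof
        assume "a = 0"
        with cA obtain y where "A = {y}" by (auto simp: card_1_singleton_iff)
        with r that show False by auto
      qed
      moreover have "real (a + b + 2) * \<theta> < pi" using cases that cA by (simp add: b_def add_ac)
      ultimately show ?thesis using \<theta> b by (intro sin_ratio_strict_subadditive) auto
    qed
    show "sin_ratio \<theta> (a + b) \<le> sin_ratio \<theta> a + sin_ratio \<theta> b"
    proof (cases "A = {r}")
      case True
      thus ?thesis by (simp add: a_def)
    next
      case False
      thus ?thesis using strict by simp
    qed
  qed
  \<comment> \<open>The scaling gives s the value \<open>sin_ratio \<theta> b * f r\<close>, the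
    prescribed drop from a parent to a child with b vertices in its branch.\<close>
  define c where "c = sin_ratio \<theta> b * f r / g s"
  define h where "h v = (if v \<in> A then f v else c * g v)" for v
  have c: "c > 0" using \<rho>b fpos[OF r] gpos[OF s] by (simp add: c_def)
  have hs: "h s = sin_ratio \<theta> b * f r" and hr: "h r = f r"
    using s r disj gpos[OF s] by (auto simp: h_def c_def)
  have hpos: "h v > 0" if "v \<in> A \<union> B" for v
    using that fpos gpos c by (auto simp: h_def)
  have NA: "nbr_sum E A h v = nbr_sum E A f v" for v
    by (rule nbr_sum_cong) (simp add: h_def)
  have NB: "nbr_sum E B h v = c * nbr_sum E B g v" for v
  proof -
    have "nbr_sum E B h v = nbr_sum E B (\<lambda>u. c * g u) v"
      by (rule nbr_sum_cong) (use disj in \<open>auto simp: h_def\<close>)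
    thus ?thesis by (simp add: nbr_sum_scale)
  qed
  have N: "nbr_sum E (A \<union> B) h v = nbr_sum E A f v + c * nbr_sum E B g v" for v
    by (simp add: nbr_sum_Un[OF fin disj] NA NB)
  have nn: "nbr_sum E A f v \<ge> 0" "c * nbr_sum E B g v \<ge> 0" for v
    using fpos gpos c by (simp_all add: nbr_sum_nonneg less_imp_le)
  have rB: "h s \<le> c * nbr_sum E B g r"
    unfolding NB[symmetric] by (rule nbr_sum_ge_member) (use fin hpos s rs in auto)
  have sA: "f r \<le> nbr_sum E A f s"
    by (rule nbr_sum_ge_member) (use fin fpos r rs symE in \<open>auto dest: symD\<close>)
  have rA: "sin_ratio \<theta> a * f r \<le> nbr_sum E A f r"
    using f by (simp add: branch_test_def a_def)
  have cgs: "c * g s = h s" using s disj by (auto simp: h_def)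
  have sB: "sin_ratio \<theta> (b - 1) * h s \<le> c * nbr_sum E B g s"
  proof -
    have "c * (sin_ratio \<theta> (b - 1) * g s) \<le> c * nbr_sum E B g s"
      using g c by (intro mult_left_mono) (auto simp: branch_test_def b_def)
    thus ?thesis by (simp add: cgs[symmetric] algebra_simps)
  qed
  have fr: "f r = h s / sin_ratio \<theta> b" using \<rho>b by (simp add: hs)
  have s_eq: "sin_ratio \<theta> (b - 1) * h s + f r = 2 * cos \<theta> * h s"
    unfolding fr cf[symmetric] by (simp add: algebra_simps)
  have vB: "2 * cos \<theta> * h v \<le> c * nbr_sum E B g v" if "v \<in> B - {s}" for v
  proof -
    have "c * (2 * cos \<theta> * g v) \<le> c * nbr_sum E B g v"
      using g c that by (intro mult_left_mono) (auto simp: branch_test_def)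
    moreover have "h v = c * g v" using that disj by (auto simp: h_def)
    ultimately show ?thesis by (simp add: algebra_simps)
  qed
  have vA: "2 * cos \<theta> * h v \<le> nbr_sum E A f v" if "v \<in> A - {r}" for v
    using f that by (auto simp: branch_test_def h_def)
  have superr: "sin_ratio \<theta> (a + b) * f r \<le> sin_ratio \<theta> a * f r + sin_ratio \<theta> b * f r"
    unfolding distrib_right[symmetric] using super fpos[OF r] by (intro mult_right_mono) auto
  have root: "sin_ratio \<theta> (a + b) * h r \<le> nbr_sum E (A \<union> B) h r"
    unfolding N hr using superr rA rB hs by linarith
  have "branch_test E \<theta> (A \<union> B) r h"
    unfolding branch_test_def cAB
  proof (intro conjI ballI)
    fix v assume v: "v \<in> A \<union> B - {r}"
    consider "v \<in> A - {r}" | "v = s" | "v \<in> B - {s}" using v by blast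
    thus "2 * cos \<theta> * h v \<le> nbr_sum E (A \<union> B) h v"
    proof cases
      case 1 thus ?thesis unfolding N using vA[of v] nn[of v] by linarith
    next
      case 2 thus ?thesis unfolding N using sA sB s_eq by simp
    next
      case 3 thus ?thesis unfolding N using vB[of v] nn[of v] by linarith
    qed
  qed (use root hpos in auto)
  moreover have "A = {r} \<and> (\<forall>u\<in>B. (r, u) \<in> E \<longleftrightarrow> u = s) \<and> branch_tight E \<theta> B s g"
    if tight: "branch_tight E \<theta> (A \<union> B) r h"
  proof (intro conjI)
    have rt: "nbr_sum E A f r + c * nbr_sum E B g r = sin_ratio \<theta> (a + b) * f r"
      using tight unfolding branch_tight_def cAB N hr by blast
    show A: "A = {r}"
    proof (rule ccontr)
      assume "A \<noteq> {r}"
      from mult_strict_right_mono[OF strict[OF this] fpos[OF r]]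
      have "sin_ratio \<theta> (a + b) * f r < sin_ratio \<theta> a * f r + sin_ratio \<theta> b * f r"
        by (simp add: distrib_right)
      thus False using rt rA rB hs by linarith
    qed
    \<comment> \<open>Equality at r leaves no slack in the part of the sum over B. The arc to s uses
      it up, and by positivity r has no other neighbour in B.\<close>
    have "nbr_sum E B h r = h s"
      using rt rA rB hs superr unfolding NB by linarith
    hence "u = s" if "u \<in> B" "(r, u) \<in> E" for u
      using nbr_sum_eq_member_imp_unique[of B h s r E u] fin hpos s rs that by auto
    thus "\<forall>u\<in>B. (r, u) \<in> E \<longleftrightarrow> u = s" using rs by blast
    show "branch_tight E \<theta> B s g"
      unfolding branch_tight_def b_def[symmetric]
    proof (intro conjI ballI)
      fix v assume v: "v \<in> B - {s}"
      have "nbr_sum E A f v + c * nbr_sum E B g v = 2 * cos \<theta> * h v"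
        using tight v r disj by (auto simp: branch_tight_def N)
      hence "c * nbr_sum E B g v = 2 * cos \<theta> * h v" using vB[OF v] nn[of v] by linarith
      moreover have "h v = c * g v" using v disj by (auto simp: h_def)
      ultimately show "nbr_sum E B g v = 2 * cos \<theta> * g v" using c by simp
    next
      have "nbr_sum E A f s + c * nbr_sum E B g s = 2 * cos \<theta> * h s"
        using tight s r disj by (auto simp: branch_tight_def N)
      hence "c * nbr_sum E B g s = sin_ratio \<theta> (b - 1) * h s" using sA sB s_eq by linarith
      thus "nbr_sum E B g s = sin_ratio \<theta> (b - 1) * g s" using c by (simp add: cgs[symmetric])
    qed
  qed
  ultimately show ?thesis by blast
qed

lemma branch_single: "branch_test E \<theta> {r} r (\<lambda>_. 1)"
  by (auto simp: branch_test_def nbr_sum_nonneg)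

text \<open>The angle stays strictly below pi, so this covers proper parts of the core only.
  Equality is traced through B alone: it forces A to be the root, which is then put in front of the
  path found in B.\<close>

lemma rtree_branch_test:
  assumes "rtree E C r" "sym E" "irrefl E" "0 < \<theta>" "real (card C + 1) * \<theta> < pi"
  shows "\<exists>f. branch_test E \<theta> C r f \<and>
    (branch_tight E \<theta> C r f \<longrightarrow> (\<exists>xs. induced_path E C xs \<and> hd xs = r))"
  using assms(1,5)
proof (induction rule: rtree.induct)
  case (single r)
  have "induced_path E {r} [r]" using assms(3) by (intro induced_path_single) (auto simp: irrefl_def)
  hence "\<exists>xs. induced_path E {r} xs \<and> hd xs = r" by (intro exI[of _ "[r]"]) simp
  thus ?case by (intro exI[of _ "\<lambda>_. 1"]) (simp add: branch_single)
next
  case (join A r B s)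
  have fin: "finite A" "finite B" using rtree_finite[OF join.hyps(1)] rtree_finite[OF join.hyps(2)] by auto
  have cAB: "card (A \<union> B) = card A + card B" using fin join by (simp add: card_Un_disjoint)
  have "real (card A + 1) * \<theta> \<le> real (card (A \<union> B) + 1) * \<theta>"
    "real (card B + 1) * \<theta> \<le> real (card (A \<union> B) + 1) * \<theta>"
    using assms(4) by (auto simp: cAB intro!: mult_right_mono)
  hence lA: "real (card A + 1) * \<theta> < pi" and lB: "real (card B + 1) * \<theta> < pi"
    using join.prems by linarith+
  from join.IH(1)[OF lA] obtain f where f: "branch_test E \<theta> A r f" by blast
  from join.IH(2)[OF lB] obtain g where g: "branch_test E \<theta> B s g"
    and path: "branch_tight E \<theta> B s g \<Longrightarrow> \<exists>xs. induced_path E B xs \<and> hd xs = s" by blast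
  have rs: "r \<in> A" "s \<in> B" using rtree_root[OF join.hyps(1)] rtree_root[OF join.hyps(2)] by auto
  obtain h where h: "branch_test E \<theta> (A \<union> B) r h"
    and tight: "branch_tight E \<theta> (A \<union> B) r h \<Longrightarrow>
      A = {r} \<and> (\<forall>u\<in>B. (r, u) \<in> E \<longleftrightarrow> u = s) \<and> branch_tight E \<theta> B s g"
    using branch_join[OF assms(2) fin join.hyps(3) rs join.hyps(4) f g assms(4) lB] join.prems
    by (auto simp: cAB)
  have "\<exists>xs. induced_path E (A \<union> B) xs \<and> hd xs = r" if "branch_tight E \<theta> (A \<union> B) r h"
  proof -
    from tight[OF that] have A: "A = {r}" and nbr: "\<And>u. u \<in> B \<Longrightarrow> (r, u) \<in> E \<longleftrightarrow> u = s"
      and "branch_tight E \<theta> B s g" by auto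
    from path[OF this(3)] obtain xs where "induced_path E B xs" "hd xs = s" by blast
    hence "induced_path E (insert r B) (r # xs)"
      using A nbr join.hyps(3) assms(2,3) rs
      by (intro induced_path_Cons[of E B xs s r]) (auto simp: irrefl_def)
    thus ?thesis using A by (intro exI[of _ "r # xs"]) simp
  qed
  thus ?case using h by blast
qed

text \<open>Without the leaf w the core is small enough for \<open>rtree_branch_test\<close>; then w
  is put on top as a root with one branch. By \<open>sin_ratio_last\<close> the weaker bound at the
  root coincides with 2 cos \<open>\<theta>\<close> at the full order.\<close>

lemma connected_path_test:
  assumes conn: "cut_connected E C" and fin: "finite C" and "C \<noteq> {}"
    and E: "sym E" "irrefl E" and \<theta>: "real (card C + 1) * \<theta> = pi"
  shows "\<exists>f. (\<forall>v\<in>C. f v > 0) \<and> (\<forall>v\<in>C. 2 * cos \<theta> * f v \<le> nbr_sum E C f v) \<and>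
    ((\<forall>v\<in>C. nbr_sum E C f v = 2 * cos \<theta> * f v) \<longrightarrow> (\<exists>xs. induced_path E C xs))"
proof -
  have cpos: "card C > 0" using assms by (simp add: card_gt_0_iff)
  have \<theta>0: "\<theta> > 0" by (rule angle_pos[OF \<theta>])
  have last: "sin_ratio \<theta> (card C - 1) = 2 * cos \<theta>"
    by (rule sin_ratio_last[OF \<theta>]) (use cpos in simp)
  have lift: ?thesis if "r \<in> C" "branch_test E \<theta> C r f"
    "branch_tight E \<theta> C r f \<Longrightarrow> \<exists>xs. induced_path E C xs" for r f
    using that last unfolding branch_test_def branch_tight_def
    by (intro exI[of _ f] conjI ballI impI) (metis Diff_iff singletonD)+
  show ?thesis
  \<comment> \<open>With one vertex there is no leaf to split off, but \<open>\<theta>\<close> is pi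
    / 2 and the required bound is 0.\<close>
  proof (cases "card C = 1")
    case True
    then obtain r where "C = {r}" by (auto simp: card_1_singleton_iff)
    thus ?thesis
      using lift[of r "\<lambda>_. 1"] branch_single[of E \<theta> r] induced_path_single[of r E] E
      by (auto simp: irrefl_def)
  next
    case False
    with cpos have "card C \<ge> 2" by simp
    then obtain w s where w: "w \<in> C" "rtree E (C - {w}) s" "(w, s) \<in> E"
      using cut_connected_leaf_rtree[OF conn fin _ E(1)] by metis
    have cB: "card (C - {w}) + 1 = card C" using w fin cpos by simp
    have lB: "real (card (C - {w}) + 1) * \<theta> < pi"
      unfolding cB using \<theta> \<theta>0 by (simp add: algebra_simps)
    from rtree_branch_test[OF w(2) E \<theta>0 lB] obtain g where g: "branch_test E \<theta> (C - {w}) s g"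
      and path: "branch_tight E \<theta> (C - {w}) s g \<Longrightarrow> \<exists>xs. induced_path E (C - {w}) xs \<and> hd xs = s"
      by blast
    have s: "s \<in> C - {w}" by (rule rtree_root[OF w(2)])
    have CU: "{w} \<union> (C - {w}) = C" using w by auto
    obtain h where h: "branch_test E \<theta> C w h" and tight: "branch_tight E \<theta> C w h \<Longrightarrow>
        (\<forall>u\<in>C - {w}. (w, u) \<in> E \<longleftrightarrow> u = s) \<and> branch_tight E \<theta> (C - {w}) s g"
      using branch_join[OF E(1) _ _ _ _ s w(3) branch_single g \<theta>0 lB] fin unfolding CU by auto
    show ?thesis
    proof (rule lift[OF w(1) h])
      assume "branch_tight E \<theta> C w h"
      from tight[OF this] have nbr: "\<And>u. u \<in> C - {w} \<Longrightarrow> (w, u) \<in> E \<longleftrightarrow> u = s"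
        and t: "branch_tight E \<theta> (C - {w}) s g" by blast+
      from path[OF t] obtain xs where "induced_path E (C - {w}) xs" "hd xs = s" by blast
      hence "induced_path E (insert w (C - {w})) (w # xs)"
        using nbr E s by (intro induced_path_Cons[of E "C - {w}" xs s w]) (auto simp: irrefl_def)
      thus "\<exists>xs. induced_path E C xs" using w(1) by (metis insert_Diff)
    qed
  qed
qed

section \<open>Domination number half the order\<close>

lemma pair_graph_arc_verts:
  assumes "pair_graph G" "(u, v) \<in> parcs G"
  shows "u \<in> pverts G" "v \<in> pverts G" "u \<noteq> v"
proof -
  interpret pair_graph G by (rule assms(1))
  show "u \<in> pverts G" "v \<in> pverts G" "u \<noteq> v"
    using assms(2) arc_fst_in_verts arc_snd_in_verts pair_no_loops by fastforce+
qed

lemma connected_imp_cut_connected: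
  assumes G: "pair_graph G" and conn: "Digraph_Component.connected (with_proj G)"
  shows "cut_connected (parcs G) (pverts G)"
  unfolding cut_connected_def
proof (intro allI impI)
  fix T assume T: "T \<subseteq> pverts G" "T \<noteq> {}" "T \<noteq> pverts G"
  interpret pair_graph G by (rule G)
  from T obtain u v where uv: "u \<in> T" "v \<in> pverts G" "v \<notin> T" by blast
  have "u \<rightarrow>\<^sup>*\<^bsub>with_proj (mk_symmetric (with_proj G))\<^esub> v"
    using conn uv T by (auto simp: Digraph_Component.connected_def strongly_connected_def)
  hence reach: "u \<rightarrow>\<^sup>*\<^bsub>with_proj G\<^esub> v"
    using reachable_mk_symmetric_eq[OF sym_arcs] by simp
  show "\<exists>u\<in>T. \<exists>v\<in>pverts G - T. (u, v) \<in> parcs G"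
  proof (rule ccontr)
    assume no: "\<not> ?thesis"
    from reach have "v \<in> T"
    proof (induction rule: reachable_induct)
      case base
      show ?case by (rule uv(1))
    next
      case (step x y)
      thus ?case using no pair_graph_arc_verts[OF G, of x y] by auto
    qed
    with uv show False by simp
  qed
qed

section \<open>Minimum dominating sets and their private neighbours\<close>

lemma dominating_set_finite: "pair_graph G \<Longrightarrow> finite {D. dominating_set G D}"
  by (rule finite_subset[of _ "Pow (pverts G)"]) (auto simp: dominating_set_def pair_graph_finite)

lemma domination_number_le:
  assumes "pair_graph G" "dominating_set G D"
  shows "domination_number G \<le> card D"
  unfolding domination_number_def using assms dominating_set_finite[OF assms(1)] by (intro Min_le) auto

lemma domination_number_attained:
  assumes "pair_graph G"
  obtains D where "dominating_set G D" "card D = domination_number G"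
proof -
  have "dominating_set G (pverts G)" by (simp add: dominating_set_def)
  hence "domination_number G \<in> card ` {D. dominating_set G D}"
    unfolding domination_number_def
    using dominating_set_finite[OF assms] by (intro Min_in) auto
  thus thesis using that by auto
qed

text \<open>Bollobas and Cockayne: among the minimum dominating sets, one that spans the most arcs has an
  external private neighbour at each of its vertices.\<close>

lemma minimum_dominating_set_private_neighbours:
  assumes G: "pair_graph G" and noniso: "\<And>v. v \<in> pverts G \<Longrightarrow> \<exists>u. (v, u) \<in> parcs G"
  obtains D where "dominating_set G D" "card D = domination_number G"
    "\<And>d. d \<in> D \<Longrightarrow> \<exists>y \<in> pverts G - D. (d, y) \<in> parcs G \<and> (\<forall>x \<in> D. (x, y) \<in> parcs G \<longrightarrow> x = d)"
proof -
  let ?V = "pverts G" and ?E = "parcs G"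
  define S where "S = {D. dominating_set G D \<and> card D = domination_number G}"
  define m where "m D = card {(a, b) \<in> ?E. a \<in> D \<and> b \<in> D}" for D
  have finE: "finite ?E"
  proof -
    interpret pair_graph G by (rule G)
    show ?thesis by (rule pair_finite_arcs)
  qed
  have finS: "finite S" using dominating_set_finite[OF G] by (auto simp: S_def)
  have "S \<noteq> {}" using domination_number_attained[OF G] by (auto simp: S_def)
  hence "Max (m ` S) \<in> m ` S" using finS by (intro Max_in) auto
  then obtain D where D: "D \<in> S" "m D = Max (m ` S)" by force
  have max: "m D' \<le> m D" if "D' \<in> S" for D' using that finS by (simp add: D(2))
  have dom: "D \<subseteq> ?V" "\<And>v. v \<in> ?V \<Longrightarrow> v \<notin> D \<Longrightarrow> \<exists>u\<in>D. (u, v) \<in> ?E"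
    and cD: "card D = domination_number G"
    using D(1) by (auto simp: S_def dominating_set_def)
  have finD: "finite D" using dom(1) pair_graph_finite[OF G] finite_subset by blast
  have symE: "(u, v) \<in> ?E \<Longrightarrow> (v, u) \<in> ?E" for u v using pair_graph_sym[OF G] by (auto dest: symD)
  have "\<exists>y \<in> ?V - D. (d, y) \<in> ?E \<and> (\<forall>x \<in> D. (x, y) \<in> ?E \<longrightarrow> x = d)" if d: "d \<in> D" for d
  proof (rule ccontr)
    assume "\<not> ?thesis"
    hence other: "\<exists>x\<in>D - {d}. (x, y) \<in> ?E" if "y \<in> ?V - D" "(d, y) \<in> ?E" for y using that by blast
    have dom': "\<exists>u\<in>D - {d}. (u, v) \<in> ?E" if "v \<in> ?V" "v \<notin> D" for v
      using dom(2)[OF that] other[of v] that by blast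
    \<comment> \<open>As d has no private neighbour, only d itself could be left undominated by
      \<open>D - {d}\<close>. A neighbour of d in D would settle that too, against
      minimality.\<close>
    have isolated: "x \<notin> D" if dx: "(d, x) \<in> ?E" for x
    proof
      assume x: "x \<in> D"
      have "x \<noteq> d" using pair_graph_arc_verts[OF G dx] by auto
      hence "dominating_set G (D - {d})"
        unfolding dominating_set_def using dom(1) dom' x symE[OF dx] by blast
      from domination_number_le[OF G this] have "card D \<le> card (D - {d})" by (simp add: cD)
      moreover have "card (D - {d}) < card D" using d finD by (rule card_Diff1_less[rotated])
      ultimately show False by simp
    qed
    obtain w where w: "(d, w) \<in> ?E" using noniso dom(1) d by blast
    have wV: "w \<in> ?V - D" using isolated[OF w] pair_graph_arc_verts[OF G w] by auto
    obtain x where x: "x \<in> D" "x \<noteq> d" "(x, w) \<in> ?E" using other[OF wV w] by blast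
    \<comment> \<open>Replacing d by its neighbour w keeps domination. No arc inside D is lost
      because d is isolated there, and the arc from x to w is gained, against the choice of
      D.\<close>
    define D' where "D' = insert w (D - {d})"
    have "dominating_set G D'"
      unfolding dominating_set_def D'_def using dom(1) dom' wV symE[OF w] by blast
    moreover have "card D' = domination_number G"
    proof -
      have "card D' = Suc (card (D - {d}))"
        unfolding D'_def by (rule card_insert_disjoint) (use finD wV in auto)
      also have "\<dots> = domination_number G" using card_Suc_Diff1[OF finD d] cD by simp
      finally show ?thesis .
    qed
    ultimately have "m D' \<le> m D" by (intro max) (simp add: S_def)
    moreover have "m D < m D'"
      unfolding m_def
    proof (rule psubset_card_mono)
      show "finite {(a, b) \<in> ?E. a \<in> D' \<and> b \<in> D'}" by (rule finite_subset[OF _ finE]) auto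
      have "{(a, b) \<in> ?E. a \<in> D \<and> b \<in> D} \<subseteq> {(a, b) \<in> ?E. a \<in> D' \<and> b \<in> D'}"
        using isolated symE by (auto simp: D'_def)
      moreover have "(x, w) \<in> {(a, b) \<in> ?E. a \<in> D' \<and> b \<in> D'}" using x by (auto simp: D'_def)
      moreover have "(x, w) \<notin> {(a, b) \<in> ?E. a \<in> D \<and> b \<in> D}" using wV by auto
      ultimately show "{(a, b) \<in> ?E. a \<in> D \<and> b \<in> D} \<subset> {(a, b) \<in> ?E. a \<in> D' \<and> b \<in> D'}" by blast
    qed
    ultimately show False by simp
  qed
  moreover have "dominating_set G D" using D(1) by (simp add: S_def)
  ultimately show thesis using that cD by blast
qed

text \<open>A cut of the core is lifted to V by placing every leaf \<open>l x\<close> on the side of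
  its partner \<open>c x\<close>. An arc crossing the lifted cut cannot meet a leaf, so it lies in
  the core.\<close>

lemma cut_connected_remove_leaves:
  assumes sym: "sym E" and conn: "cut_connected E V"
    and disj: "c ` D \<inter> l ` D = {}" and V: "c ` D \<union> l ` D = V"
    and leaf: "\<And>x v. x \<in> D \<Longrightarrow> v \<in> V \<Longrightarrow> (l x, v) \<in> E \<Longrightarrow> v = c x"
  shows "cut_connected E (c ` D)"
  unfolding cut_connected_def
proof (intro allI impI)
  fix T assume T: "T \<subseteq> c ` D" "T \<noteq> {}" "T \<noteq> c ` D"
  define T' where "T' = T \<union> l ` {x \<in> D. c x \<in> T}"
  have "T' \<subseteq> V" using T V by (auto simp: T'_def)
  moreover have "T' \<noteq> {}" using T by (simp add: T'_def)
  moreover have "T' \<noteq> V"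
  proof -
    obtain y where "y \<in> D" "c y \<notin> T" using T by blast
    hence "c y \<notin> T'" "c y \<in> V" using disj V by (auto simp: T'_def)
    thus ?thesis by blast
  qed
  ultimately obtain u v where uv: "u \<in> T'" "v \<in> V" "v \<notin> T'" "(u, v) \<in> E"
    using conn unfolding cut_connected_def by blast
  have "u \<in> T"
  proof (rule ccontr)
    assume "u \<notin> T"
    then obtain x where x: "x \<in> D" "c x \<in> T" "u = l x" using uv(1) by (auto simp: T'_def)
    hence "v = c x" using leaf uv by blast
    thus False using uv x by (simp add: T'_def)
  qed
  moreover have "v \<in> c ` D"
  proof (rule ccontr)
    assume "v \<notin> c ` D"
    then obtain y where y: "y \<in> D" "v = l y" using uv V by blast
    have "u = c y" using leaf[OF y(1), of u] y(2) uv \<open>T' \<subseteq> V\<close> symD[OF sym uv(4)] by blast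
    thus False using uv y \<open>u \<in> T\<close> by (auto simp: T'_def)
  qed
  ultimately show "\<exists>u\<in>T. \<exists>v\<in>c ` D - T. (u, v) \<in> E" using uv by (auto simp: T'_def)
qed

text \<open>Half of the vertices lie in D, so private neighbours give a bijection \<open>p\<close>
  from D onto the complement. Privacy leaves only the arcs inside D, those inside the complement,
  and the matching. Outside the exceptional case one end of each matched pair is a leaf, and the
  other ends form the core.\<close>

lemma half_domination_spanning_corona:
  assumes G: "pair_graph G" and conn: "cut_connected (parcs G) (pverts G)"
    and card: "card (pverts G) = 2 * k" and k: "k \<ge> 1" and dom: "domination_number G = k"
  obtains C q where "C \<subseteq> pverts G" "bij_betw q C (pverts G - C)" "\<And>c. c \<in> C \<Longrightarrow> (c, q c) \<in> parcs G"
    "cut_connected (parcs G) C" "card C = k"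
proof -
  let ?V = "pverts G" and ?E = "parcs G"
  have symE: "(u, v) \<in> ?E \<Longrightarrow> (v, u) \<in> ?E" for u v using pair_graph_sym[OF G] by (auto dest: symD)
  have finV: "finite ?V" by (rule pair_graph_finite[OF G])
  have "\<exists>u. (v, u) \<in> ?E" if "v \<in> ?V" for v
  proof -
    have "{v} \<noteq> ?V"
    proof
      assume "{v} = ?V"
      hence "card ?V = 1" by (metis is_singletonI is_singleton_altdef)
      thus False using card by simp
    qed
    thus ?thesis using conn that unfolding cut_connected_def by blast
  qed
  then obtain D where D: "dominating_set G D" "card D = k" and
    "\<And>d. d \<in> D \<Longrightarrow> \<exists>y \<in> ?V - D. (d, y) \<in> ?E \<and> (\<forall>x \<in> D. (x, y) \<in> ?E \<longrightarrow> x = d)"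
    using minimum_dominating_set_private_neighbours[OF G] dom by metis
  then obtain p where p: "\<And>d. d \<in> D \<Longrightarrow> p d \<in> ?V - D" "\<And>d. d \<in> D \<Longrightarrow> (d, p d) \<in> ?E"
    and priv: "\<And>d x. d \<in> D \<Longrightarrow> x \<in> D \<Longrightarrow> (x, p d) \<in> ?E \<Longrightarrow> x = d"
    by metis
  have DV: "D \<subseteq> ?V" using D(1) by (simp add: dominating_set_def)
  have finD: "finite D" using DV finV finite_subset by blast
  have inj: "inj_on p D" by (rule inj_onI) (metis p(2) priv)
  have pD: "p ` D = ?V - D"
  proof (rule card_subset_eq)
    show "card (p ` D) = card (?V - D)"
      using inj D(2) card DV finD by (simp add: card_image card_Diff_subset)
  qed (use finV p in auto)
  have bij: "bij_betw p D (?V - D)" using inj pD by (simp add: bij_betw_def)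
  \<comment> \<open>Otherwise e dominates d and \<open>p f\<close> dominates f and \<open>p d\<close>, which saves one vertex of D.\<close>
  have no_cross: "e = f" if d: "d \<in> D" and e: "e \<in> D" "e \<noteq> d" "(d, e) \<in> ?E"
    and f: "f \<in> D" "f \<noteq> d" "(p d, p f) \<in> ?E" for d e f
  proof (rule ccontr)
    assume ef: "e \<noteq> f"
    define D1 where "D1 = insert (p f) (D - {d, f})"
    have "\<exists>u\<in>D1. (u, v) \<in> ?E" if v: "v \<in> ?V" "v \<notin> D1" for v
    proof (cases "v \<in> D")
      case True
      hence "v = d \<or> v = f" using v by (auto simp: D1_def)
      thus ?thesis
      proof
        assume "v = d"
        thus ?thesis using e ef symE by (auto simp: D1_def)
      next
        assume "v = f"
        thus ?thesis using p(2)[OF f(1)] symE by (auto simp: D1_def)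
      qed
    next
      case False
      then obtain x where x: "x \<in> D" "v = p x" using pD v by blast
      consider "x = d" | "x = f" | "x \<in> D1" using x by (auto simp: D1_def)
      thus ?thesis
      proof cases
        case 1 thus ?thesis using x f symE by (auto simp: D1_def)
      next
        case 2 thus ?thesis using x v by (auto simp: D1_def)
      next
        case 3 thus ?thesis using x p(2) by auto
      qed
    qed
    moreover have "D1 \<subseteq> ?V" using DV p f by (auto simp: D1_def)
    ultimately have "dominating_set G D1" by (auto simp: dominating_set_def)
    from domination_number_le[OF G this] have "k \<le> card D1" using dom by simp
    also have "card D1 \<le> Suc (card (D - {d, f}))" unfolding D1_def by (rule card_insert_le_m1) auto
    also have "card (D - {d, f}) = k - 2"
      using d f finD D(2) by (simp add: card_Diff_subset)
    finally have "k \<le> Suc (k - 2)" .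
    moreover have "card {d, f} \<le> card D" using d f finD by (intro card_mono) auto
    hence "k \<ge> 2" using f(2) D(2) by simp
    ultimately show False by simp
  qed
  \<comment> \<open>The first case contains the 4-cycle, the only graph here that need not be a corona.\<close>
  show thesis
  proof (cases "\<exists>d\<in>D. \<exists>e\<in>D. \<exists>f\<in>D. e \<noteq> d \<and> (d, e) \<in> ?E \<and> f \<noteq> d \<and> (p d, p f) \<in> ?E")
    case True
    then obtain d e where d: "d \<in> D" and e: "e \<in> D" "e \<noteq> d" "(d, e) \<in> ?E" "(p d, p e) \<in> ?E"
      using no_cross by metis
    note e' = symE[OF e(3)] symE[OF e(4)]
    define T where "T = {d, e, p d, p e}"
    \<comment> \<open>By privacy an arc leaving T stays inside D or inside the complement of D. Then
      \<open>no_cross\<close>, with the opposite side of the 4-cycle, identifies its far end with a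
      vertex of T.\<close>
    have "T = ?V"
    proof (rule ccontr)
      assume "T \<noteq> ?V"
      moreover have "T \<subseteq> ?V" "T \<noteq> {}" using d e DV p by (auto simp: T_def)
      ultimately obtain u v where uv: "u \<in> T" "v \<in> ?V" "v \<notin> T" "(u, v) \<in> ?E"
        using conn unfolding cut_connected_def by blast
      show False
      proof (cases "v \<in> D")
        case True
        have "u \<noteq> p d" "u \<noteq> p e" using priv[of _ v] symE[OF uv(4)] True d e uv(3) by (auto simp: T_def)
        hence "u = d \<or> u = e" using uv(1) by (auto simp: T_def)
        moreover have "v \<noteq> d" "v \<noteq> e" using uv(3) by (auto simp: T_def)
        ultimately show False
          using no_cross[OF d True _ _ e(1,2,4)] no_cross[OF e(1) True _ _ d e(2)[symmetric] e'(2)] uv(4)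
          by blast
      next
        case False
        then obtain g where g: "g \<in> D" "v = p g" using pD uv by blast
        have "u \<noteq> d" "u \<noteq> e" using priv[OF g(1), of u] d e uv g by (auto simp: T_def)
        hence "u = p d \<or> u = p e" using uv(1) by (auto simp: T_def)
        moreover have "g \<noteq> d" "g \<noteq> e" using uv(3) g(2) by (auto simp: T_def)
        ultimately show False
          using no_cross[OF d e(1-3) g(1)] no_cross[OF e(1) d e(2)[symmetric] e'(1) g(1)] uv(4) g(2)
          by blast
      qed
    qed
    hence "D = {d, e}" using DV d e p by (auto simp: T_def)
    have "cut_connected ?E D"
      unfolding cut_connected_def
    proof (intro allI impI)
      fix T assume T: "T \<subseteq> D" "T \<noteq> {}" "T \<noteq> D"
      show "\<exists>u\<in>T. \<exists>v\<in>D - T. (u, v) \<in> ?E"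
      proof (cases "d \<in> T")
        case True
        hence "e \<notin> T" using T \<open>D = {d, e}\<close> by blast
        thus ?thesis using True e by blast
      next
        case False
        hence "e \<in> T" using T \<open>D = {d, e}\<close> by blast
        thus ?thesis using False d e'(1) by blast
      qed
    qed
    thus thesis using that DV bij p(2) D(2) by blast
  next
    case False
    \<comment> \<open>If \<open>p x\<close> has a neighbour among the other private neighbours, then
      x has none in D, since the exceptional case is excluded. So x becomes the leaf; otherwise
      \<open>p x\<close> does.\<close>
    define out where "out x \<longleftrightarrow> (\<exists>f\<in>D. f \<noteq> x \<and> (p x, p f) \<in> ?E)" for x
    define c where "c x = (if out x then p x else x)" for x
    define l where "l x = (if out x then x else p x)" for x
    have nD: "p x \<notin> D" if "x \<in> D" for x using p that by auto
    have pinj: "p x = p y \<longleftrightarrow> x = y" if "x \<in> D" "y \<in> D" for x y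
      using inj that by (auto dest: inj_onD)
    have injc: "inj_on c D" and injl: "inj_on l D"
      by (intro inj_onI; auto simp: c_def l_def pinj split: if_splits dest: nD)+
    have disj: "c ` D \<inter> l ` D = {}"
      by (auto simp: c_def l_def pinj split: if_splits dest: nD)
    have V: "c ` D \<union> l ` D = ?V"
    proof
      show "c ` D \<union> l ` D \<subseteq> ?V" using DV p by (auto simp: c_def l_def)
      show "?V \<subseteq> c ` D \<union> l ` D"
      proof
        fix v assume "v \<in> ?V"
        then obtain x where "x \<in> D" "v = x \<or> v = p x" using pD by blast
        thus "v \<in> c ` D \<union> l ` D" by (auto simp: c_def l_def image_iff)
      qed
    qed
    have leaf: "v = c x" if x: "x \<in> D" and v: "v \<in> ?V" and lv: "(l x, v) \<in> ?E" for x v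
    proof (cases "out x")
      case True
      have xv: "(x, v) \<in> ?E" using lv True by (simp add: l_def)
      hence "v \<noteq> x" using pair_graph_arc_verts[OF G] by blast
      have "v \<notin> D" using False True x xv \<open>v \<noteq> x\<close> unfolding out_def by blast
      then obtain g where "g \<in> D" "v = p g" using v pD by blast
      thus ?thesis using priv[of g x] x xv True by (auto simp: c_def)
    next
      case nout: False
      have xv: "(p x, v) \<in> ?E" using lv nout by (simp add: l_def)
      hence "v \<noteq> p x" using pair_graph_arc_verts[OF G] by blast
      have "v \<in> D"
      proof (rule ccontr)
        assume "v \<notin> D"
        then obtain g where "g \<in> D" "v = p g" using v pD by blast
        thus False using nout xv \<open>v \<noteq> p x\<close> by (auto simp: out_def)
      qed
      thus ?thesis using priv[OF x, of v] symE[OF xv] nout by (simp add: c_def)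
    qed
    have cc: "cut_connected ?E (c ` D)"
      by (rule cut_connected_remove_leaves[OF pair_graph_sym[OF G] conn disj V leaf])
    define q where "q v = l (inv_into D c v)" for v
    have qc: "q (c x) = l x" if "x \<in> D" for x using that injc by (simp add: q_def)
    have "bij_betw q (c ` D) (?V - c ` D)"
    proof (rule bij_betw_imageI)
      show "inj_on q (c ` D)"
      proof (rule inj_onI)
        fix u v assume "u \<in> c ` D" "v \<in> c ` D" "q u = q v"
        then obtain x y where "x \<in> D" "y \<in> D" "u = c x" "v = c y" "l x = l y" using qc by auto
        thus "u = v" using inj_onD[OF injl, of x y] by simp
      qed
      have "q ` (c ` D) = l ` D" using qc by (simp add: image_image)
      moreover have "B = X - A" if "A \<inter> B = {}" "A \<union> B = X" for A B X :: "'a set"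
        using that by blast
      ultimately show "q ` (c ` D) = ?V - c ` D" using disj V by simp
    qed
    moreover have "(x, q x) \<in> ?E" if "x \<in> c ` D" for x
    proof -
      from that obtain y where y: "y \<in> D" "x = c y" by blast
      hence "q x = l y" using qc by simp
      thus ?thesis using y p(2)[OF y(1)] symE by (simp add: c_def l_def)
    qed
    moreover have "card (c ` D) = k" using injc D(2) by (simp add: card_image)
    moreover have "c ` D \<subseteq> ?V" unfolding V[symmetric] by (rule Un_upper1)
    ultimately show thesis using cc by (intro that[of "c ` D" q])
  qed
qed

section \<open>Coronas\<close>

text \<open>In a pair digraph the arc map and the end maps of an isomorphism are determined by the
  vertex map. The bijection starts at the model H, where vertices can be listed explicitly, and is
  inverted here.\<close>

lemma digraph_isoI_bij:
  assumes G: "pair_graph G" and H: "pair_graph H" and bij: "bij_betw \<psi> (pverts H) (pverts G)"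
    and arcs: "\<And>u v. u \<in> pverts H \<Longrightarrow> v \<in> pverts H \<Longrightarrow> (\<psi> u, \<psi> v) \<in> parcs G \<longleftrightarrow> (u, v) \<in> parcs H"
  shows "digraph_iso (with_proj G) (with_proj H)"
proof -
  interpret G: pair_graph G by (rule G)
  define \<phi> where "\<phi> = inv_into (pverts H) \<psi>"
  have \<phi>: "bij_betw \<phi> (pverts G) (pverts H)" unfolding \<phi>_def by (rule bij_betw_inv_into[OF bij])
  have \<psi>\<phi>: "\<psi> (\<phi> u) = u" if "u \<in> pverts G" for u
    unfolding \<phi>_def using bij that by (rule bij_betw_inv_into_right)
  have \<phi>V: "\<phi> u \<in> pverts H" if "u \<in> pverts G" for u using \<phi> that by (rule bij_betwE[rule_format])
  have arcs': "(\<phi> u, \<phi> v) \<in> parcs H \<longleftrightarrow> (u, v) \<in> parcs G" if "u \<in> pverts G" "v \<in> pverts G" for u v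
    using arcs[OF \<phi>V[OF that(1)] \<phi>V[OF that(2)]] that by (simp add: \<psi>\<phi>)
  define hom where "hom = \<lparr> iso_verts = \<phi>, iso_arcs = (\<lambda>(u, v). (\<phi> u, \<phi> v)),
    iso_head = snd, iso_tail = fst \<rparr>"
  have inj: "inj_on \<phi> (pverts G)" using \<phi> by (simp add: bij_betw_def)
  have "inj_on (\<lambda>(u, v). (\<phi> u, \<phi> v)) (pverts G \<times> pverts G)"
    using inj by (auto simp: inj_on_def)
  moreover have "parcs G \<subseteq> pverts G \<times> pverts G"
    using pair_graph_arc_verts[OF G] by auto
  ultimately have "inj_on (\<lambda>(u, v). (\<phi> u, \<phi> v)) (parcs G)"
    by (rule inj_on_subset)
  hence "pre_digraph.digraph_isomorphism (with_proj G) hom"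
    unfolding pre_digraph.digraph_isomorphism_def
    using inj G.wf_digraph_axioms by (auto simp: hom_def)
  moreover have "(\<lambda>(u, v). (\<phi> u, \<phi> v)) ` parcs G = parcs H"
  proof (intro subset_antisym subsetI)
    fix a assume "a \<in> (\<lambda>(u, v). (\<phi> u, \<phi> v)) ` parcs G"
    then obtain u v where "(u, v) \<in> parcs G" "a = (\<phi> u, \<phi> v)" by auto
    thus "a \<in> parcs H" using arcs'[of u v] pair_graph_arc_verts[OF G, of u v] by simp
  next
    fix a assume a: "a \<in> parcs H"
    obtain x y where xy: "a = (x, y)" by (cases a)
    have "x \<in> pverts H" "y \<in> pverts H" using pair_graph_arc_verts[OF H] a xy by auto
    then obtain u v where uv: "u \<in> pverts G" "v \<in> pverts G" "x = \<phi> u" "y = \<phi> v"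
      using bij_betw_imp_surj_on[OF \<phi>] by (metis imageE)
    hence "(u, v) \<in> parcs G" using arcs' a xy by simp
    thus "a \<in> (\<lambda>(u, v). (\<phi> u, \<phi> v)) ` parcs G" using uv xy by (auto intro!: rev_image_eqI)
  qed
  hence "with_proj H = app_iso hom (with_proj G)"
    using \<phi> by (simp add: app_iso_def hom_def with_proj_def bij_betw_def)
  ultimately show ?thesis unfolding digraph_iso_def by blast
qed

lemma digraph_isoE_bij:
  assumes G: "pair_graph G" and iso: "digraph_iso (with_proj G) (with_proj H)"
  obtains \<phi> where "bij_betw \<phi> (pverts G) (pverts H)"
    "\<And>u v. u \<in> pverts G \<Longrightarrow> v \<in> pverts G \<Longrightarrow> (\<phi> u, \<phi> v) \<in> parcs H \<longleftrightarrow> (u, v) \<in> parcs G"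
proof -
  interpret G: pair_graph G by (rule G)
  from iso obtain hom where hom: "pre_digraph.digraph_isomorphism (with_proj G) hom"
    and H: "with_proj H = app_iso hom (with_proj G)" unfolding digraph_iso_def by blast
  let ?\<phi> = "iso_verts hom" and ?\<alpha> = "iso_arcs hom"
  have inj: "inj_on ?\<phi> (pverts G)"
    using hom by (simp add: pre_digraph.digraph_isomorphism_def)
  have \<alpha>: "?\<alpha> (u, v) = (?\<phi> u, ?\<phi> v)" if "(u, v) \<in> parcs G" for u v
  proof -
    \<comment> \<open>Comparing the end maps on both sides of \<open>H\<close> fixes those of
      \<open>hom\<close>, so its arc map must act componentwise.\<close>
    have "iso_tail hom = fst" "iso_head hom = snd"
      using arg_cong[OF H, of tail] arg_cong[OF H, of head] by (simp_all add: with_proj_def)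
    thus ?thesis using hom that
      by (intro prod_eqI) (fastforce simp: pre_digraph.digraph_isomorphism_def with_proj_def)+
  qed
  have V: "pverts H = ?\<phi> ` pverts G" and A: "parcs H = ?\<alpha> ` parcs G"
    using arg_cong[OF H, of verts] arg_cong[OF H, of arcs] by simp_all
  have "(?\<phi> u, ?\<phi> v) \<in> parcs H \<longleftrightarrow> (u, v) \<in> parcs G" if uv: "u \<in> pverts G" "v \<in> pverts G" for u v
  proof
    assume "(u, v) \<in> parcs G"
    thus "(?\<phi> u, ?\<phi> v) \<in> parcs H" unfolding A using \<alpha> by (metis image_eqI)
  next
    assume "(?\<phi> u, ?\<phi> v) \<in> parcs H"
    then obtain x y where xy: "(x, y) \<in> parcs G" "(?\<phi> u, ?\<phi> v) = ?\<alpha> (x, y)" unfolding A by auto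
    hence "?\<phi> u = ?\<phi> x" "?\<phi> v = ?\<phi> y" using \<alpha> by auto
    hence "u = x" "v = y" using inj_onD[OF inj] uv pair_graph_arc_verts[OF G xy(1)] by blast+
    thus "(u, v) \<in> parcs G" using xy by simp
  qed
  moreover have "bij_betw ?\<phi> (pverts G) (pverts H)" using inj V by (simp add: bij_betw_def)
  ultimately show thesis using that by blast
qed

lemma nbr_sum_bij:
  assumes bij: "bij_betw \<phi> V W"
    and arcs: "\<And>u v. u \<in> V \<Longrightarrow> v \<in> V \<Longrightarrow> (\<phi> u, \<phi> v) \<in> F \<longleftrightarrow> (u, v) \<in> E" and v: "v \<in> V"
  shows "nbr_sum E V (\<lambda>u. f (\<phi> u)) v = nbr_sum F W f (\<phi> v)"
proof -
  have "bij_betw \<phi> {u \<in> V. (v, u) \<in> E} {u \<in> W. (\<phi> v, u) \<in> F}"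
    using bij arcs v by (auto simp: bij_betw_def inj_on_def)
  thus ?thesis unfolding nbr_sum_def by (rule sum.reindex_bij_betw)
qed

section \<open>The extremal graph and its eigenvector\<close>

lemma corona_path_nbr_sum_core:
  assumes "i < k"
  shows "nbr_sum (parcs (corona_K1 (path_graph k))) (pverts (corona_K1 (path_graph k))) f (Inl i) =
    (if 0 < i then f (Inl (i - 1)) else 0) + (if Suc i < k then f (Inl (Suc i)) else 0) + f (Inr i)"
proof -
  let ?H = "corona_K1 (path_graph k)"
  have "{u \<in> pverts ?H. (Inl i, u) \<in> parcs ?H} =
      (if 0 < i then {Inl (i - 1)} else {}) \<union> (if Suc i < k then {Inl (Suc i)} else {}) \<union> {Inr i}"
    using assms by (auto simp: corona_K1_def path_graph_def)
  thus ?thesis unfolding nbr_sum_def by (simp add: sum.union_disjoint)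
qed

lemma corona_path_nbr_sum_pendant:
  assumes "i < k"
  shows "nbr_sum (parcs (corona_K1 (path_graph k))) (pverts (corona_K1 (path_graph k))) f (Inr i) =
    f (Inl i)"
proof -
  let ?H = "corona_K1 (path_graph k)"
  have "{u \<in> pverts ?H. (Inr i, u) \<in> parcs ?H} = {Inl i}"
    using assms by (auto simp: corona_K1_def path_graph_def)
  thus ?thesis unfolding nbr_sum_def by simp
qed

text \<open>The equation at a pendant vertex forces the core entry divided by \<open>\<mu>\<close>.
  In the core this adds 1 / \<open>\<mu>\<close> to the path eigenvalue 2 cos
  \<open>\<theta>\<close>, which makes \<open>\<mu>\<close>.\<close>

lemma corona_path_positive_eigenvector:
  assumes \<theta>: "real (k + 1) * \<theta> = pi" and k: "k \<ge> 1" and \<mu>: "\<mu> > 0" "\<mu> - 1 / \<mu> = 2 * cos \<theta>"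
  defines "H \<equiv> corona_K1 (path_graph k)"
  obtains f where "\<And>v. v \<in> pverts H \<Longrightarrow> f v > 0"
    "\<And>v. v \<in> pverts H \<Longrightarrow> nbr_sum (parcs H) (pverts H) f v = \<mu> * f v"
proof -
  define s where "s i = sin (real i * \<theta>)" for i
  define f where "f = case_sum (\<lambda>i. s (Suc i)) (\<lambda>i. s (Suc i) / \<mu>)"
  have \<theta>0: "\<theta> > 0" by (rule angle_pos[OF \<theta>])
  have kpi: "real k * \<theta> < pi" using \<theta> \<theta>0 by (simp add: algebra_simps)
  have spos: "s (Suc i) > 0" if "i < k" for i
    unfolding s_def by (rule sin_mult_pos[OF \<theta>0 kpi]) (use that in auto)
  \<comment> \<open>Path vertex i carries entry i + 1; the zeros at positions 0 and k + 1 stand in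
    for the missing neighbours of the two ends.\<close>
  have s0: "s 0 = 0" "s (Suc k) = 0"
    using \<theta> by (simp_all add: s_def)
  have pv: "pverts H = Inl ` {..<k} \<union> Inr ` {..<k}"
    by (auto simp: H_def corona_K1_def path_graph_def)
  have "f v > 0" if "v \<in> pverts H" for v
    using that spos \<mu> by (auto simp: pv f_def)
  moreover have "nbr_sum (parcs H) (pverts H) f v = \<mu> * f v" if "v \<in> pverts H" for v
  proof -
    from that consider i where "i < k" "v = Inl i" | i where "i < k" "v = Inr i"
      by (auto simp: pv)
    thus ?thesis
    proof cases
      case 1
      have "(if 0 < i then f (Inl (i - 1)) else 0) = s i" using s0 by (cases i) (auto simp: f_def)
      moreover have "(if Suc i < k then f (Inl (Suc i)) else 0) = s (Suc (Suc i))"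
        using s0 1 by (cases "Suc i = k") (auto simp: f_def)
      moreover have "s i + s (Suc (Suc i)) = 2 * cos \<theta> * s (Suc i)"
        using sin_three_term[of "real (Suc i) * \<theta>" \<theta>] by (simp add: s_def algebra_simps)
      ultimately have "nbr_sum (parcs H) (pverts H) f v = (\<mu> - 1 / \<mu>) * s (Suc i) + s (Suc i) / \<mu>"
        using 1 by (simp add: H_def corona_path_nbr_sum_core \<mu>(2)) (simp add: f_def)
      thus ?thesis using 1 by (simp add: f_def algebra_simps)
    next
      case 2
      thus ?thesis using \<mu> by (simp add: H_def corona_path_nbr_sum_pendant) (simp add: f_def)
    qed
  qed
  ultimately show thesis using that by blast
qed

lemma corona_digraph_iso:
  assumes G: "pair_graph G" and C: "C \<subseteq> pverts G" and q: "bij_betw q C (pverts G - C)"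
    and qarc: "\<And>c. c \<in> C \<Longrightarrow> (c, q c) \<in> parcs G"
    and pendant: "\<And>c u. c \<in> C \<Longrightarrow> (q c, u) \<in> parcs G \<Longrightarrow> u = c"
    and path: "induced_path (parcs G) C xs"
  shows "digraph_iso (with_proj G) (with_proj (corona_K1 (path_graph (card C))))"
proof -
  let ?k = "card C"
  let ?H = "corona_K1 (path_graph ?k)"
  have xs: "distinct xs" "set xs = C" using path by (auto simp: induced_path_def)
  hence len: "length xs = ?k" using distinct_card by fastforce
  have xarc: "(xs ! i, xs ! j) \<in> parcs G \<longleftrightarrow> j = Suc i \<or> i = Suc j" if "i < ?k" "j < ?k" for i j
    using path that len by (auto simp: induced_path_def)
  have xC: "xs ! i \<in> C" if "i < ?k" for i using that xs len nth_mem by metis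
  have xinj: "xs ! i = xs ! j \<longleftrightarrow> i = j" if "i < ?k" "j < ?k" for i j
    using that xs len by (simp add: nth_eq_iff_index_eq)
  have qC: "q c \<in> pverts G - C" if "c \<in> C" for c using q that by (auto simp: bij_betw_def)
  have qinj: "q c = q d \<longleftrightarrow> c = d" if "c \<in> C" "d \<in> C" for c d
    using q that by (auto simp: bij_betw_def dest: inj_onD)
  have sym: "(u, v) \<in> parcs G \<longleftrightarrow> (v, u) \<in> parcs G" for u v
    using pair_graph_sym[OF G] by (auto dest: symD)
  define \<psi> where "\<psi> = case_sum (\<lambda>i. xs ! i) (\<lambda>i. q (xs ! i))"
  have \<psi>[simp]: "\<psi> (Inl i) = xs ! i" "\<psi> (Inr i) = q (xs ! i)" for i by (simp_all add: \<psi>_def)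
  have pv: "pverts ?H = Inl ` {..<?k} \<union> Inr ` {..<?k}"
    by (auto simp: corona_K1_def path_graph_def)
  have img: "(\<lambda>i. xs ! i) ` {..<?k} = C"
    using xs len by (auto simp: set_conv_nth)
  show ?thesis
  proof (rule digraph_isoI_bij[OF G pair_graph_corona_K1[OF pair_graph_path_graph]])
    show "bij_betw \<psi> (pverts ?H) (pverts G)"
    proof (rule bij_betw_imageI)
      show "inj_on \<psi> (pverts ?H)"
      proof (rule inj_onI)
        fix u v assume "u \<in> pverts ?H" "v \<in> pverts ?H" "\<psi> u = \<psi> v"
        thus "u = v" unfolding pv
          using xinj qinj xC qC by (elim UnE imageE) (auto, (metis DiffD2)+)
      qed
      have "\<psi> ` pverts ?H = (\<lambda>i. xs ! i) ` {..<?k} \<union> q ` ((\<lambda>i. xs ! i) ` {..<?k})"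
        by (simp add: pv image_Un image_image)
      also have "\<dots> = C \<union> q ` C" by (simp only: img)
      also have "q ` C = pverts G - C" using q by (simp add: bij_betw_def)
      finally show "\<psi> ` pverts ?H = pverts G" using C by auto
    qed
  next
    fix u v assume u: "u \<in> pverts ?H" and v: "v \<in> pverts ?H"
    have pend: "(q (xs ! i), w) \<in> parcs G \<longleftrightarrow> w = xs ! i" if "i < ?k" for i w
      using pendant[OF xC[OF that]] qarc[OF xC[OF that]] sym by blast
    have pend': "(w, q (xs ! i)) \<in> parcs G \<longleftrightarrow> w = xs ! i" if "i < ?k" for i w
      using pend[OF that] sym by blast
    have ne: "q (xs ! i) \<noteq> xs ! j" if "i < ?k" "j < ?k" for i j
      using xC[OF that(2)] qC[OF xC[OF that(1)]] by auto
    show "(\<psi> u, \<psi> v) \<in> parcs G \<longleftrightarrow> (u, v) \<in> parcs ?H"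
      using u v unfolding pv
      by (elim UnE imageE) (auto simp: xarc pend pend' ne xinj corona_K1_def path_graph_def)
  qed
qed

text \<open>Pendant vertices get the value of their partner divided by \<open>\<mu>\<close>, as in
  the path corona; extra arcs only enlarge neighbour sums. If the bound is attained, the core
  inequality for f is an equality and a pendant vertex has no neighbour besides its partner.\<close>

lemma corona_subinvariant_vector:
  assumes G: "pair_graph G" and C: "C \<subseteq> pverts G" and q: "bij_betw q C (pverts G - C)"
    and qarc: "\<And>c. c \<in> C \<Longrightarrow> (c, q c) \<in> parcs G" and "C \<noteq> {}"
    and \<mu>: "\<mu> > 0" "\<mu> - 1 / \<mu> = \<nu>"
    and f: "\<And>c. c \<in> C \<Longrightarrow> f c > 0" "\<And>c. c \<in> C \<Longrightarrow> \<nu> * f c \<le> nbr_sum (parcs G) C f c"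
  shows "\<mu> \<le> graph_spectral_radius G"
    and "graph_spectral_radius G = \<mu> \<Longrightarrow> c \<in> C \<Longrightarrow> nbr_sum (parcs G) C f c = \<nu> * f c"
    and "graph_spectral_radius G = \<mu> \<Longrightarrow> c \<in> C \<Longrightarrow> (q c, u) \<in> parcs G \<Longrightarrow> u = c"
proof -
  let ?V = "pverts G" and ?E = "parcs G"
  have fin: "finite ?V" by (rule pair_graph_finite[OF G])
  hence finC: "finite C" "finite (?V - C)" using C finite_subset by auto
  define F where "F v = (if v \<in> C then f v else f (inv_into C q v) / \<mu>)" for v
  have qC: "q c \<in> ?V - C" if "c \<in> C" for c using q that by (auto simp: bij_betw_def)
  have Fq: "F (q c) = f c / \<mu>" if "c \<in> C" for c
    using qC[OF that] q that by (simp add: F_def bij_betw_def)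
  have FC: "F c = f c" if "c \<in> C" for c using that by (simp add: F_def)
  have split: "v \<in> C \<or> (\<exists>c\<in>C. v = q c)" if "v \<in> ?V" for v
    using q that by (auto simp: bij_betw_def)
  have Fpos: "F v > 0" if "v \<in> ?V" for v
    using split[OF that] f(1) \<mu>(1) by (auto simp: FC Fq)
  have N: "nbr_sum ?E ?V F v = nbr_sum ?E C f v + nbr_sum ?E (?V - C) F v" for v
  proof -
    have "nbr_sum ?E ?V F v = nbr_sum ?E C F v + nbr_sum ?E (?V - C) F v"
      using nbr_sum_Un[OF finC, of ?E F v] C by (simp add: Un_absorb1)
    thus ?thesis using nbr_sum_cong[of C F f ?E v] FC by simp
  qed
  have core: "f c / \<mu> \<le> nbr_sum ?E (?V - C) F c" if "c \<in> C" for c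
    using nbr_sum_ge_member[of "?V - C" F "q c" c ?E] finC Fpos qC[OF that] qarc[OF that] Fq[OF that]
    by simp
  have qarc': "(q c, c) \<in> ?E" if "c \<in> C" for c
    using qarc[OF that] pair_graph_sym[OF G] by (auto dest: symD)
  have pend: "\<mu> * F (q c) \<le> nbr_sum ?E ?V F (q c)" if "c \<in> C" for c
    using nbr_sum_ge_member[of ?V F c "q c" ?E] fin Fpos qarc'[OF that] C that \<mu>(1)
    by (auto simp: Fq FC)
  have split\<mu>: "\<mu> * f c = \<nu> * f c + f c / \<mu>" for c
    unfolding \<mu>(2)[symmetric] by (simp add: algebra_simps)
  have sub: "\<mu> * F v \<le> nbr_sum ?E ?V F v" if "v \<in> ?V" for v
    using split[OF that]
  proof
    assume v: "v \<in> C"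
    show ?thesis unfolding N FC[OF v] split\<mu> using core[OF v] f(2)[OF v] by linarith
  qed (use pend in auto)
  have ne: "?V \<noteq> {}" using C \<open>C \<noteq> {}\<close> by auto
  show "\<mu> \<le> graph_spectral_radius G"
    by (rule subinvariant_vector_le_spectral_radius(1)[OF G ne Fpos sub])
  assume eq: "graph_spectral_radius G = \<mu>" and c: "c \<in> C"
  have tight: "nbr_sum ?E ?V F v = \<mu> * F v" if "v \<in> ?V" for v
    by (rule subinvariant_vector_le_spectral_radius(2)[OF G ne Fpos sub eq that])
  have "c \<in> ?V" using C c by auto
  from tight[OF this] have "nbr_sum ?E C f c + nbr_sum ?E (?V - C) F c = \<nu> * f c + f c / \<mu>"
    unfolding N FC[OF c] split\<mu> .
  thus "nbr_sum ?E C f c = \<nu> * f c" using core[OF c] f(2)[OF c] by linarith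
  assume u: "(q c, u) \<in> ?E"
  have "nbr_sum ?E ?V F (q c) = F c"
    using tight[of "q c"] qC[OF c] \<mu>(1) by (simp add: Fq[OF c] FC[OF c])
  thus "u = c"
    using nbr_sum_eq_member_imp_unique[of ?V F c "q c" ?E u] fin Fpos C c qarc'[OF c] u
      pair_graph_arc_verts[OF G u] by auto
qed

theorem theorem5p4:
  fixes n :: nat and G :: "'a pair_pre_digraph"
  assumes "n \<ge> 2" and "even n"
    and "G \<in> connected_graphs_dom n (n div 2)"
  shows "graph_spectral_radius G \<ge> graph_spectral_radius (corona_K1 (path_graph (n div 2))) \<and>
    (graph_spectral_radius G = graph_spectral_radius (corona_K1 (path_graph (n div 2))) \<longleftrightarrow>
      digraph_iso (with_proj G) (with_proj (corona_K1 (path_graph (n div 2)))))"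
proof -
  define k where "k = n div 2"
  let ?H = "corona_K1 (path_graph k)"
  have k: "k \<ge> 1" "n = 2 * k" unfolding k_def using assms(1,2) by auto
  have G: "pair_graph G" and conn: "Digraph_Component.connected (with_proj G)"
    and card: "card (pverts G) = 2 * k" and dom: "domination_number G = k"
    using assms(3) k(2) unfolding connected_graphs_dom_def k_def by simp_all
  have H: "pair_graph ?H" by (rule pair_graph_corona_K1[OF pair_graph_path_graph])
  define \<theta> where "\<theta> = pi / real (k + 1)"
  have \<theta>: "real (k + 1) * \<theta> = pi" by (simp add: \<theta>_def)
  \<comment> \<open>The positive root of x^2 - 2 cos \<open>\<theta>\<close> x - 1, that is, of x -
    1 / x = 2 cos \<open>\<theta>\<close>.\<close>
  define \<mu> where "\<mu> = cos \<theta> + sqrt ((cos \<theta>)\<^sup>2 + 1)"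
  have "\<bar>cos \<theta>\<bar> < sqrt ((cos \<theta>)\<^sup>2 + 1)" by (rule real_less_rsqrt) simp
  hence \<mu>0: "\<mu> > 0" by (simp add: \<mu>_def)
  have "\<mu> * \<mu> = 2 * cos \<theta> * \<mu> + 1"
  proof -
    have "sqrt ((cos \<theta>)\<^sup>2 + 1) * sqrt ((cos \<theta>)\<^sup>2 + 1) = cos \<theta> * cos \<theta> + 1"
      by (simp add: power2_eq_square)
    thus ?thesis unfolding \<mu>_def by (simp only: algebra_simps)
  qed
  hence \<mu>: "\<mu> - 1 / \<mu> = 2 * cos \<theta>" using \<mu>0 by (simp add: field_simps)
  obtain g where g: "\<And>v. v \<in> pverts ?H \<Longrightarrow> g v > 0"
    "\<And>v. v \<in> pverts ?H \<Longrightarrow> nbr_sum (parcs ?H) (pverts ?H) g v = \<mu> * g v"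
    using corona_path_positive_eigenvector[OF \<theta> k(1) \<mu>0 \<mu>] by blast
  have "Inl 0 \<in> pverts ?H" using k by (auto simp: corona_K1_def path_graph_def)
  hence \<rho>H: "graph_spectral_radius ?H = \<mu>"
    by (intro spectral_radius_eq_positive_eigenvector[OF H _ g]) auto
  have Vne: "pverts G \<noteq> {}" using card k by auto
  obtain C q where C: "C \<subseteq> pverts G" and q: "bij_betw q C (pverts G - C)"
    and qarc: "\<And>c. c \<in> C \<Longrightarrow> (c, q c) \<in> parcs G"
    and Cconn: "cut_connected (parcs G) C" and cC: "card C = k"
    using half_domination_spanning_corona[OF G connected_imp_cut_connected[OF G conn] card k(1) dom]
    by blast
  have finC: "finite C" "C \<noteq> {}" using cC k by (auto intro: card_ge_0_finite)
  have irr: "irrefl (parcs G)" using pair_graph_arc_verts(3)[OF G] by (auto simp: irrefl_def)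
  obtain f where f: "\<And>v. v \<in> C \<Longrightarrow> f v > 0"
    "\<And>v. v \<in> C \<Longrightarrow> 2 * cos \<theta> * f v \<le> nbr_sum (parcs G) C f v"
    and path: "(\<And>v. v \<in> C \<Longrightarrow> nbr_sum (parcs G) C f v = 2 * cos \<theta> * f v) \<Longrightarrow>
      \<exists>xs. induced_path (parcs G) C xs"
    using connected_path_test[OF Cconn finC pair_graph_sym[OF G] irr, of \<theta>] \<theta> cC by auto
  note sub = corona_subinvariant_vector[OF G C q qarc finC(2) \<mu>0 \<mu> f]
  have "digraph_iso (with_proj G) (with_proj ?H)" if eq: "graph_spectral_radius G = \<mu>"
  proof -
    obtain xs where "induced_path (parcs G) C xs" using path sub(2)[OF _ _ _ eq] by blast
    thus ?thesis
      using corona_digraph_iso[OF G C q qarc sub(3)[OF _ _ _ eq]] cC by auto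
  qed
  \<comment> \<open>For the converse the eigenvector of the path corona is pulled back along the
    vertex bijection; being positive, it determines the spectral radius of G.\<close>
  moreover have "graph_spectral_radius G = \<mu>" if iso: "digraph_iso (with_proj G) (with_proj ?H)"
  proof -
    obtain \<phi> where \<phi>: "bij_betw \<phi> (pverts G) (pverts ?H)"
      "\<And>u v. u \<in> pverts G \<Longrightarrow> v \<in> pverts G \<Longrightarrow> (\<phi> u, \<phi> v) \<in> parcs ?H \<longleftrightarrow> (u, v) \<in> parcs G"
      using digraph_isoE_bij[OF G iso] by blast
    have \<phi>V: "\<phi> v \<in> pverts ?H" if "v \<in> pverts G" for v using \<phi>(1) that by (auto simp: bij_betw_def)
    show ?thesis
    proof (rule spectral_radius_eq_positive_eigenvector[OF G Vne])
      show "g (\<phi> v) > 0" if "v \<in> pverts G" for v using g(1)[OF \<phi>V[OF that]] .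
      show "nbr_sum (parcs G) (pverts G) (\<lambda>v. g (\<phi> v)) v = \<mu> * g (\<phi> v)" if "v \<in> pverts G" for v
        using nbr_sum_bij[OF \<phi> that, of g] g(2)[OF \<phi>V[OF that]] by simp
    qed
  qed
  ultimately show ?thesis unfolding k_def[symmetric] \<rho>H using sub(1) by blast
qed

end
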